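(* Let $0 < \varepsilon < 1$ and let $k$ be a positive integer with $k \ge 10 + 2(1-\varepsilon)/\varepsilon$. Then there is $n_0 = n_0(k,\varepsilon)$ such that for every $n \ge n_0$ there exists a function $f : \{0,1\}^n \to \{0,1\}^k$ such that, with $(x,y)$ drawn from $(x,y)_\varepsilon$, for all $z \in \{0,1\}^k$ $$\Pr[f(x) = z] = 2^{-k} \quad\text{and}\quad \Pr[f(x) = f(y) = z \mid f(x) = f(y)] = 2^{-k},$$ and moreover $$\Pr_{(x,y)_\varepsilon}[f(x) = f(y)] \ge 0.003\,(\varepsilon k)^{-1/2}\, 2^{-k\varepsilon/(1-\varepsilon)}.$$
   Context: The distribution $(x,y)_\varepsilon$ on $\{0,1\}^n \times \{0,1\}^n$ is defined as follows: the pairs $(x_i, y_i)$, $i = 1, \dots, n$, are independent, and each takes the values $(0,0)$ and $(1,1)$ with probability $(1-\varepsilon)/2$ each and the values $(0,1)$ and $(1,0)$ with probability $\varepsilon/2$ each. *)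

theory Defs
  imports "HOL-Probability.Probability"
begin

text \<open>The set \<open>{0,1}\<^sup>n\<close>; \<^const>\<open>False\<close> stands for \<open>0\<close> and \<^const>\<open>True\<close> for \<open>1\<close>.\<close>

definition bitstrings :: "nat \<Rightarrow> bool list set" where
  "bitstrings n = {x. length x = n}"

text \<open>Like every use of \<^const>\<open>embed_pmf\<close>, this is meaningful only when the given weights form a
  distribution, i.e. for \<open>0 \<le> \<epsilon> \<le> 1\<close>; see \<open>pmf_noisy_bit_pair\<close>.\<close>

definition noisy_bit_pair :: "real \<Rightarrow> (bool \<times> bool) pmf" where
  "noisy_bit_pair \<epsilon> = embed_pmf (\<lambda>(a, b). if a = b then (1 - \<epsilon>) / 2 else \<epsilon> / 2)"

lemma pmf_noisy_bit_pair:
  assumes "0 \<le> \<epsilon>" "\<epsilon> \<le> 1"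
  shows "pmf (noisy_bit_pair \<epsilon>) (a, b) = (if a = b then (1 - \<epsilon>) / 2 else \<epsilon> / 2)"
proof -
  let ?w = "\<lambda>(a::bool, b::bool). if a = b then (1 - \<epsilon>) / 2 else \<epsilon> / 2"
  have U: "(UNIV :: (bool \<times> bool) set) = {(False, False), (False, True), (True, False), (True, True)}"
    by auto
  have nn: "\<And>p. 0 \<le> ?w p"
    using assms by auto
  have "(\<integral>\<^sup>+ p. ennreal (?w p) \<partial>count_space UNIV) = (\<Sum>p\<in>UNIV. ennreal (?w p))"
    by (intro nn_integral_count_space_finite) simp
  also have "\<dots> = ennreal (\<Sum>p\<in>UNIV. ?w p)"
    by (intro sum_ennreal nn)
  also have "(\<Sum>p\<in>UNIV. ?w p) = 1"
    by (simp add: U field_simps)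
  finally show ?thesis
    unfolding noisy_bit_pair_def using pmf_embed_pmf[of ?w "(a, b)"] nn by simp
qed

text \<open>The distribution \<open>(x,y)\<^sub>\<epsilon>\<close>: draw the \<open>n\<close> pairs \<open>(x\<^sub>i, y\<^sub>i)\<close> independently and split the
  resulting list of pairs into the two strings.\<close>

definition noisy_pair :: "nat \<Rightarrow> real \<Rightarrow> (bool list \<times> bool list) pmf" where
  "noisy_pair n \<epsilon> = map_pmf (\<lambda>ps. (map fst ps, map snd ps)) (replicate_pmf n (noisy_bit_pair \<epsilon>))"

end

theory Submission
  imports Defs "HOL-Real_Asymp.Real_Asymp"
begin

text \<open>
  Let \<open>N = 2\<^sup>k\<close>. Split the input into \<open>N\<close> blocks indexed by \<open>{0,1}\<^sup>k\<close>, each of length \<open>m\<close>,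
  and \<open>k\<close> further bits \<open>w\<close>; output the index of a block that lies in a fixed set \<open>A\<close>, using \<open>w\<close>
  only to break ties. The group \<open>{0,1}\<^sup>k\<close> acts by permuting the blocks and shifting \<open>w\<close>. This action
  preserves the distribution of \<open>(x,y)\<close> and commutes with the function, so both uniformity claims
  are exact. Both outputs are \<open>z\<close> as soon as \<open>z\<close> is the only index whose block is in \<open>A\<close>, for \<open>x\<close>
  and for \<open>y\<close>, so the agreement probability is at least
  \<open>N P(x \<in> A, y \<in> A) P(x \<notin> A, y \<notin> A)\<^bsup>N-1\<^esup>\<close>.

  For \<open>A\<close> take a half space \<open>X > t \<surd>m\<close>, where \<open>X\<close> is the sum of the signs of a block, of Gaussian
  measure about \<open>1/(2N)\<close>. Writing \<open>X = U + V\<close> and \<open>Y = U - V\<close>, with \<open>U\<close> the sum over the positions where \<open>x\<close>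
  and \<open>y\<close> agree and \<open>V\<close> the sum over the others, the event \<open>U > (t + s) \<surd>m, \<bar>V\<bar> \<le> s \<surd>m\<close> forces
  \<open>X, Y > t \<surd>m\<close>. Given the number of disagreements, \<open>U\<close> and \<open>V\<close> are independent simple random walks, and the
  one-dimensional central limit theorem applies to each. The choice \<open>s = (1 - \<epsilon>) / t\<close> loses only
  a constant factor.
\<close>

subsection \<open>Equivariant functions built from one event\<close>

definition xor_bits :: "bool list \<Rightarrow> bool list \<Rightarrow> bool list" where
  "xor_bits a b = map2 (\<noteq>) a b"

lemma length_xor_bits [simp]: "length (xor_bits a b) = min (length a) (length b)"
  by (simp add: xor_bits_def)

lemma nth_xor_bits [simp]:
  "i < length a \<Longrightarrow> i < length b \<Longrightarrow> xor_bits a b ! i = (a ! i \<noteq> b ! i)"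
  by (simp add: xor_bits_def)

lemma xor_bits_in_bitstrings [simp]:
  "a \<in> bitstrings k \<Longrightarrow> b \<in> bitstrings k \<Longrightarrow> xor_bits a b \<in> bitstrings k"
  by (simp add: bitstrings_def)

lemma xor_bits_commute: "xor_bits a b = xor_bits b a"
  by (rule nth_equalityI) auto

lemma xor_bits_assoc: "xor_bits (xor_bits a b) c = xor_bits a (xor_bits b c)"
  by (rule nth_equalityI) auto

lemma xor_bits_cancel [simp]: "length a = length b \<Longrightarrow> xor_bits a (xor_bits a b) = b"
  by (rule nth_equalityI) auto

lemma bij_betw_xor_bits:
  assumes "a \<in> bitstrings k"
  shows "bij_betw (xor_bits a) (bitstrings k) (bitstrings k)"
  by (rule bij_betw_byWitness[where f' = "xor_bits a"])
    (use assms in \<open>auto simp: bitstrings_def\<close>)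

lemma finite_bitstrings [simp]: "finite (bitstrings k)"
  and card_bitstrings [simp]: "card (bitstrings k) = 2 ^ k"
  using finite_lists_length_eq[of "UNIV :: bool set" k] card_lists_length_eq[of "UNIV :: bool set" k]
  by (simp_all add: bitstrings_def)

text \<open>The shifts act simply transitively on the values of the first coordinate and preserve
  both \<open>L\<close> and \<open>R\<close>. So the \<open>2 ^ k\<close> events that partition
  \<open>R\<close> by the value of \<open>u\<close> are equally likely.\<close>

lemma measure_fst_eq_uniform:
  fixes L :: "(bool list \<times> bool list) pmf"
  assumes supp: "\<And>u v. (u, v) \<in> set_pmf L \<Longrightarrow> u \<in> bitstrings k"
    and inv: "\<And>a. a \<in> bitstrings k \<Longrightarrow> map_pmf (\<lambda>(u, v). (xor_bits a u, xor_bits a v)) L = L"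
    and R: "\<And>a u v. a \<in> bitstrings k \<Longrightarrow> (u, v) \<in> set_pmf L \<Longrightarrow>
      R (xor_bits a u) (xor_bits a v) \<longleftrightarrow> R u v"
    and z: "z \<in> bitstrings k"
  shows "measure_pmf.prob L {(u, v). u = z \<and> R u v} = measure_pmf.prob L {(u, v). R u v} / 2 ^ k"
proof -
  define E where "E z = {(u, v). u = z \<and> R u v}" for z
  have eq: "measure_pmf.prob L (E z') = measure_pmf.prob L (E z)" if z': "z' \<in> bitstrings k" for z'
  proof -
    \<comment> \<open>The unique shift carrying \<open>z\<close> to \<open>z'\<close>.\<close>
    define a where "a = xor_bits z z'"
    have a: "a \<in> bitstrings k" using z z' by (simp add: a_def)
    have "xor_bits a u = z' \<longleftrightarrow> u = z" if "u \<in> bitstrings k" for u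
    proof
      assume "xor_bits a u = z'"
      then have "xor_bits z z' = xor_bits z (xor_bits a u)" by simp
      also have "\<dots> = xor_bits (xor_bits z (xor_bits z z')) u"
        by (simp add: a_def xor_bits_assoc)
      finally have "xor_bits z z' = xor_bits z' u" using z z' by (simp add: bitstrings_def)
      then have "xor_bits z' (xor_bits z' z) = xor_bits z' (xor_bits z' u)"
        by (simp add: xor_bits_commute)
      then show "u = z" using z z' that by (simp add: bitstrings_def)
    qed (use z z' in \<open>simp add: a_def bitstrings_def xor_bits_commute[of _ z]\<close>)
    then have "measure_pmf.prob (map_pmf (\<lambda>(u, v). (xor_bits a u, xor_bits a v)) L) (E z')
        = measure_pmf.prob L (E z)"
      unfolding measure_map_pmf
      by (intro measure_pmf.finite_measure_eq_AE) (auto simp: AE_measure_pmf_iff E_def R[OF a] dest: supp)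
    then show ?thesis by (simp add: inv[OF a])
  qed
  have "measure_pmf.prob L {(u, v). R u v} = measure_pmf.prob L (\<Union>z\<in>bitstrings k. E z)"
    by (intro measure_pmf.finite_measure_eq_AE) (auto simp: AE_measure_pmf_iff E_def dest: supp)
  also have "\<dots> = (\<Sum>z\<in>bitstrings k. measure_pmf.prob L (E z))"
    by (rule measure_pmf.finite_measure_finite_Union) (auto simp: E_def disjoint_family_on_def)
  also have "\<dots> = 2 ^ k * measure_pmf.prob L (E z)"
    by (simp add: eq)
  finally show ?thesis by (simp add: E_def)
qed

section \<open>Independent blocks and equivariant choice\<close>

lemma map_pmf_map2_replicate_pmf:
  assumes "\<And>c. c \<in> set a \<Longrightarrow> map_pmf (g c) p = p"
  shows "map_pmf (map2 g a) (replicate_pmf (length a) p) = replicate_pmf (length a) p"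
  using assms
proof (induction a)
  case (Cons c a)
  have "map_pmf (map2 g (c # a)) (replicate_pmf (length (c # a)) p) =
      map_pmf (g c) p \<bind> (\<lambda>x. map_pmf (map2 g a) (replicate_pmf (length a) p) \<bind>
        (\<lambda>xs. return_pmf (x # xs)))"
    by (simp add: map_pmf_def bind_assoc_pmf bind_return_pmf)
  then show ?case using Cons by simp
qed simp

text \<open>Lets one long string be viewed as a family of independent blocks labelled by
  \<open>set zs\<close>, the view in which permuting blocks is easy. Peeling off the first block
  works because its label does not recur.\<close>

lemma replicate_pmf_concat:
  assumes "distinct zs"
  shows "map_pmf (\<lambda>B. concat (map B zs)) (Pi_pmf (set zs) d (\<lambda>_. replicate_pmf m p))
    = replicate_pmf (length zs * m) p"
  using assms
proof (induction zs)
  case (Cons z zs)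
  have *: "concat (map (B(z := b)) zs) = concat (map B zs)" for B :: "'a \<Rightarrow> 'b list" and b
    using Cons.prems by (intro arg_cong[of _ _ concat] map_cong) auto
  have "map_pmf (\<lambda>B. concat (map B (z # zs))) (Pi_pmf (set (z # zs)) d (\<lambda>_. replicate_pmf m p))
     = replicate_pmf m p \<bind> (\<lambda>b. map_pmf (\<lambda>B. concat (map B zs))
         (Pi_pmf (set zs) d (\<lambda>_. replicate_pmf m p)) \<bind> (\<lambda>ys. return_pmf (b @ ys)))"
    using Cons.prems
    by (simp add: Pi_pmf_insert' map_pmf_def bind_assoc_pmf bind_return_pmf * fun_upd_def[symmetric]
        del: fun_upd_apply) (simp add: *)
  then show ?case using Cons by (simp add: replicate_pmf_distrib add.commute)
qed simp

text \<open>Left inverse of \<open>concat (map B zs)\<close>: the block is addressed by its label,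
  its position being that of the label in \<open>zs\<close>.\<close>

fun block :: "'a list \<Rightarrow> nat \<Rightarrow> 'a \<Rightarrow> 'b list \<Rightarrow> 'b list" where
  "block [] m z xs = []"
| "block (z' # zs) m z xs = (if z' = z then take m xs else block zs m z (drop m xs))"

lemma block_concat:
  assumes "\<And>z. z \<in> set zs \<Longrightarrow> length (B z) = m" "z \<in> set zs"
  shows "block zs m z (concat (map B zs) @ xs) = B z"
  using assms by (induction zs) auto

text \<open>Picks an element of \<open>T\<close>, or any bit string if there is none. Choosing among the shifts by \<open>w\<close>
  of the elements of \<open>T\<close>, instead of among the elements, makes the choice equivariant under
  simultaneous shifts of \<open>T\<close> and \<open>w\<close>.\<close>

definition pick_shifted :: "nat \<Rightarrow> bool list set \<Rightarrow> bool list \<Rightarrow> bool list" where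
  "pick_shifted k T w = xor_bits w (SOME s. s \<in> bitstrings k \<and>
     (T \<inter> bitstrings k \<noteq> {} \<longrightarrow> s \<in> xor_bits w ` (T \<inter> bitstrings k)))"

lemma pick_shifted_cong:
  "T \<inter> bitstrings k = T' \<inter> bitstrings k \<Longrightarrow> pick_shifted k T w = pick_shifted k T' w"
  by (simp add: pick_shifted_def)

lemma pick_shifted_some:
  assumes "w \<in> bitstrings k"
  obtains s where "s \<in> bitstrings k" "T \<inter> bitstrings k \<noteq> {} \<Longrightarrow> s \<in> xor_bits w ` (T \<inter> bitstrings k)"
    "pick_shifted k T w = xor_bits w s"
proof -
  have "\<exists>s. s \<in> bitstrings k \<and> (T \<inter> bitstrings k \<noteq> {} \<longrightarrow> s \<in> xor_bits w ` (T \<inter> bitstrings k))"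
    using assms xor_bits_in_bitstrings[OF assms assms] xor_bits_in_bitstrings[OF assms]
    by (cases "T \<inter> bitstrings k = {}") blast+
  from someI_ex[OF this] show ?thesis
    by (intro that) (auto simp: pick_shifted_def)
qed

lemma pick_shifted_in_bitstrings: "w \<in> bitstrings k \<Longrightarrow> pick_shifted k T w \<in> bitstrings k"
  by (rule pick_shifted_some[of w k T]) simp_all

lemma pick_shifted_singleton:
  assumes "w \<in> bitstrings k" "T \<inter> bitstrings k = {z}"
  shows "pick_shifted k T w = z"
proof (rule pick_shifted_some[OF assms(1), of T])
  fix s assume "T \<inter> bitstrings k \<noteq> {} \<Longrightarrow> s \<in> xor_bits w ` (T \<inter> bitstrings k)"
    and *: "pick_shifted k T w = xor_bits w s"
  then have "s = xor_bits w z" using assms(2) by simp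
  moreover have "z \<in> bitstrings k" using assms(2) by blast
  ultimately show ?thesis using assms(1) by (simp add: * bitstrings_def)
qed

lemma pick_shifted_xor_bits:
  assumes "a \<in> bitstrings k" "w \<in> bitstrings k"
  shows "pick_shifted k {z. xor_bits a z \<in> T} (xor_bits a w) = xor_bits a (pick_shifted k T w)"
proof -
  have "{z. xor_bits a z \<in> T} \<inter> bitstrings k = xor_bits a ` (T \<inter> bitstrings k)"
  proof (intro equalityI subsetI)
    fix z assume z: "z \<in> {z. xor_bits a z \<in> T} \<inter> bitstrings k"
    show "z \<in> xor_bits a ` (T \<inter> bitstrings k)"
      by (rule image_eqI[where x = "xor_bits a z"]) (use z assms in \<open>simp_all add: bitstrings_def\<close>)
  qed (use assms in \<open>auto simp: bitstrings_def\<close>)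
  moreover have "xor_bits (xor_bits a w) (xor_bits a z) = xor_bits w z" if "z \<in> bitstrings k" for z
    using that assms by (intro nth_equalityI) (auto simp: bitstrings_def)
  then have "xor_bits (xor_bits a w) ` xor_bits a ` (T \<inter> bitstrings k) = xor_bits w ` (T \<inter> bitstrings k)"
    unfolding image_image by (intro image_cong refl) blast
  ultimately show ?thesis
    by (simp add: pick_shifted_def xor_bits_assoc)
qed

text \<open>The weight of a pair depends only on whether its bits agree, which a common flip
  preserves.\<close>

lemma map_flip_noisy_bit_pair:
  assumes "0 \<le> \<epsilon>" "\<epsilon> \<le> 1"
  shows "map_pmf (\<lambda>(a, b). (c \<noteq> a, c \<noteq> b)) (noisy_bit_pair \<epsilon>) = noisy_bit_pair \<epsilon>"
proof (rule pmf_eqI)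
  fix q :: "bool \<times> bool"
  let ?g = "\<lambda>(a, b). (c \<noteq> a, c \<noteq> b)"
  have g: "?g (?g q) = q" for q by (cases q) auto
  have inj: "inj ?g" by (rule inj_on_inverseI[where g = ?g]) (rule g)
  have "pmf (map_pmf ?g (noisy_bit_pair \<epsilon>)) (?g (?g q)) = pmf (noisy_bit_pair \<epsilon>) (?g q)"
    by (rule pmf_map_inj') (rule inj)
  then show "pmf (map_pmf ?g (noisy_bit_pair \<epsilon>)) q = pmf (noisy_bit_pair \<epsilon>) q"
    unfolding g using assms by (cases q) (auto simp: pmf_noisy_bit_pair)
qed

text \<open>The function built reads just the first \<open>2 ^ k * m + k\<close> bits, so a single
  block length \<open>m\<close> serves every larger \<open>n\<close>.\<close>

lemma exists_equivariant_function:
  fixes A :: "bool list set" and m k n :: nat and \<epsilon> :: real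
  assumes \<epsilon>: "0 \<le> \<epsilon>" "\<epsilon> \<le> 1" and n: "n \<ge> 2 ^ k * m + k"
  defines "M \<equiv> measure_pmf.prob (noisy_pair n \<epsilon>)"
  shows "\<exists>f \<in> bitstrings n \<rightarrow> bitstrings k.
    (\<forall>z\<in>bitstrings k. M {(x, y). f x = z} = 1 / 2 ^ k \<and>
       M {(x, y). f x = f y \<and> f y = z} = M {(x, y). f x = f y} / 2 ^ k) \<and>
    M {(x, y). f x = f y} \<ge> 2 ^ k * measure_pmf.prob (noisy_pair m \<epsilon>) (A \<times> A) *
      measure_pmf.prob (noisy_pair m \<epsilon>) ((- A) \<times> (- A)) ^ (2 ^ k - 1)"
proof -
  let ?p = "noisy_bit_pair \<epsilon>"
  let ?Z = "bitstrings k"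
  obtain zs where zs: "set zs = ?Z" "distinct zs"
    using finite_distinct_list[OF finite_bitstrings] by blast
  then have len_zs: "length zs = 2 ^ k"
    using distinct_card by fastforce
  define f where "f x = pick_shifted k {z \<in> ?Z. block zs m z x \<in> A} (take k (drop (2 ^ k * m) x))" for x
  \<comment> \<open>The same randomness, arranged as labelled blocks of pairs together with the
    tie-breaking pairs. \<open>F fst\<close> and \<open>F snd\<close> are the values
    \<open>f x\<close> and \<open>f y\<close> in this arrangement.\<close>
  define \<Omega> where "\<Omega> = pair_pmf (Pi_pmf ?Z [] (\<lambda>_. replicate_pmf m ?p)) (replicate_pmf k ?p)"
  define F where "F c \<omega> = pick_shifted k {z \<in> ?Z. map c (fst \<omega> z) \<in> A} (map c (snd \<omega>))"
    for c :: "bool \<times> bool \<Rightarrow> bool" and \<omega> :: "(bool list \<Rightarrow> (bool \<times> bool) list) \<times> (bool \<times> bool) list"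
  have len: "length (fst \<omega> z) = m" "length (snd \<omega>) = k" if "\<omega> \<in> set_pmf \<Omega>" "z \<in> ?Z" for \<omega> z
    using that by (auto simp: \<Omega>_def set_Pi_pmf PiE_dflt_def set_replicate_pmf)
  have Znz: "replicate k False \<in> ?Z" by (simp add: bitstrings_def)
  define L where "L = map_pmf (\<lambda>\<omega>. (F fst \<omega>, F snd \<omega>)) \<Omega>"
  have f_eq: "f (map c (concat (map (fst \<omega>) zs) @ snd \<omega> @ r)) = F c \<omega>" if "\<omega> \<in> set_pmf \<Omega>" for c \<omega> r
  proof -
    have "block zs m z (map c (concat (map (fst \<omega>) zs) @ snd \<omega> @ r)) = map c (fst \<omega> z)" if "z \<in> ?Z" for z
      using block_concat[of zs "\<lambda>z. map c (fst \<omega> z)" m z "map c (snd \<omega> @ r)"] that zs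
        len(1)[OF \<open>\<omega> \<in> set_pmf \<Omega>\<close>] by (simp add: map_concat o_def)
    moreover have "length (map c (concat (map (fst \<omega>) zs))) = 2 ^ k * m"
    proof -
      have "map (length \<circ> fst \<omega>) zs = map (\<lambda>_. m) zs"
        using zs len(1)[OF that] by auto
      then show ?thesis by (simp add: length_concat len_zs map_replicate_const sum_list_replicate)
    qed
    ultimately show ?thesis
      using len(2)[OF that Znz] by (simp add: f_def F_def cong: conj_cong)
  qed
  obtain r where r: "n = 2 ^ k * m + (k + r)" using n by (metis le_Suc_ex add.assoc)
  have "replicate_pmf n ?p = \<Omega> \<bind> (\<lambda>\<omega>. replicate_pmf r ?p \<bind>
      (\<lambda>R. return_pmf (concat (map (fst \<omega>) zs) @ snd \<omega> @ R)))"
    unfolding r replicate_pmf_distrib \<Omega>_def pair_pmf_def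
    unfolding len_zs[symmetric] replicate_pmf_concat[OF zs(2), of "[]", symmetric]
    unfolding zs(1) map_pmf_def by (simp add: bind_assoc_pmf bind_return_pmf)
  then have L: "map_pmf (\<lambda>(x, y). (f x, f y)) (noisy_pair n \<epsilon>) = L"
    unfolding noisy_pair_def L_def
    by (simp add: map_pmf_def bind_assoc_pmf bind_return_pmf f_eq del: map_append cong: bind_pmf_cong_simp)
  have inv_L: "map_pmf (\<lambda>(u, v). (xor_bits a u, xor_bits a v)) L = L" if a: "a \<in> ?Z" for a
  proof -
    \<comment> \<open>The shift \<open>a\<close> permutes the labels and flips the tie-breaking
      bits. Extending the permutation by the identity keeps labels outside \<open>?Z\<close>
      outside, where the blocks have their default value.\<close>
    define B' where "B' B = B \<circ> (\<lambda>z. if z \<in> ?Z then xor_bits a z else z)"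
      for B :: "bool list \<Rightarrow> (bool \<times> bool) list"
    define W' where "W' = map2 (\<lambda>c (p, q). (c \<noteq> p, c \<noteq> q)) a"
    have "map_pmf (map_prod B' W') \<Omega> = \<Omega>"
    proof -
      have "bij_betw (\<lambda>z. if z \<in> ?Z then xor_bits a z else z) ?Z ?Z"
        using bij_betw_xor_bits[OF a] by (simp cong: bij_betw_cong)
      then have "map_pmf B' (Pi_pmf ?Z [] (\<lambda>_. replicate_pmf m ?p)) = Pi_pmf ?Z [] (\<lambda>_. replicate_pmf m ?p)"
        unfolding B'_def by (intro Pi_pmf_bij_betw[symmetric]) auto
      moreover have "map_pmf W' (replicate_pmf k ?p) = replicate_pmf k ?p"
        using map_pmf_map2_replicate_pmf[of a "\<lambda>c (p, q). (c \<noteq> p, c \<noteq> q)" ?p] a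
          map_flip_noisy_bit_pair[OF \<epsilon>] unfolding W'_def by (simp add: bitstrings_def)
      ultimately show ?thesis
        unfolding \<Omega>_def by (simp add: map_prod_def map_pair)
    qed
    moreover have "F c (map_prod B' W' \<omega>) = xor_bits a (F c \<omega>)"
      if \<omega>: "\<omega> \<in> set_pmf \<Omega>" and c: "c = fst \<or> c = snd" for c \<omega>
    proof -
      have w: "map c (snd \<omega>) \<in> ?Z" using len(2)[OF \<omega> Znz] by (simp add: bitstrings_def)
      have "map c (W' (snd \<omega>)) = xor_bits a (map c (snd \<omega>))"
        using c by (auto simp: W'_def xor_bits_def zip_map2 split_beta)
      then have "F c (map_prod B' W' \<omega>) =
          pick_shifted k {z. xor_bits a z \<in> {z \<in> ?Z. map c (fst \<omega> z) \<in> A}} (xor_bits a (map c (snd \<omega>)))"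
        using a by (auto simp: F_def B'_def intro!: pick_shifted_cong)
      then show ?thesis
        unfolding pick_shifted_xor_bits[OF a w] by (simp add: F_def)
    qed
    then have "map_pmf (\<lambda>(u, v). (xor_bits a u, xor_bits a v)) L
        = map_pmf (\<lambda>\<omega>. (F fst \<omega>, F snd \<omega>)) (map_pmf (map_prod B' W') \<Omega>)"
      unfolding L_def map_pmf_comp by (intro map_pmf_cong) auto
    ultimately show ?thesis
      by (simp add: L_def)
  qed
  have F_in: "F c \<omega> \<in> ?Z" if "\<omega> \<in> set_pmf \<Omega>" for c \<omega>
    unfolding F_def
    by (rule pick_shifted_in_bitstrings) (use len(2)[OF that Znz] in \<open>simp add: bitstrings_def\<close>)
  have supp_L: "u \<in> ?Z \<and> v \<in> ?Z" if "(u, v) \<in> set_pmf L" for u v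
    using that by (auto simp: L_def F_in)
  have M_L: "M {(x, y). R (f x) (f y)} = measure_pmf.prob L {(u, v). R u v}" for R
    unfolding M_def L[symmetric] measure_map_pmf by (intro arg_cong[of _ _ "measure_pmf.prob _"]) auto
  \<comment> \<open>Taking \<open>R\<close> to be always true gives the uniformity of
    \<open>f x\<close>; taking equality gives the uniformity of the common value.\<close>
  have unif: "M {(x, y). f x = z \<and> R (f x) (f y)} = M {(x, y). R (f x) (f y)} / 2 ^ k"
    if "z \<in> ?Z" and R: "\<And>a u v. a \<in> ?Z \<Longrightarrow> u \<in> ?Z \<Longrightarrow> v \<in> ?Z \<Longrightarrow> R (xor_bits a u) (xor_bits a v) \<longleftrightarrow> R u v"
    for z R
  proof -
    have "measure_pmf.prob L {(u, v). u = z \<and> R u v} = measure_pmf.prob L {(u, v). R u v} / 2 ^ k"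
      by (rule measure_fst_eq_uniform) (use supp_L inv_L R that in blast)+
    then show ?thesis
      using M_L[of "\<lambda>u v. u = z \<and> R u v"] M_L[of R] by simp
  qed
  have xor_inj: "xor_bits a u = xor_bits a v \<longleftrightarrow> u = v" if "a \<in> ?Z" "u \<in> ?Z" "v \<in> ?Z" for a u v
    using bij_betw_xor_bits[OF that(1)] that by (auto simp: bij_betw_def inj_on_eq_iff)
  have agree: "M {(x, y). f x = f y \<and> f y = z} = M {(x, y). f x = f y} / 2 ^ k" if "z \<in> ?Z" for z
  proof -
    have "{(x, y). f x = f y \<and> f y = z} = {(x, y). f x = z \<and> f x = f y}" by auto
    then show ?thesis using unif[OF that, of "(=)"] xor_inj by simp
  qed
  define z0 where "z0 = replicate k False"
  define J where "J = measure_pmf.prob (noisy_pair m \<epsilon>) (A \<times> A)"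
  define K where "K = measure_pmf.prob (noisy_pair m \<epsilon>) ((- A) \<times> (- A))"
  have "J * K ^ (2 ^ k - 1) \<le> measure_pmf.prob L {(u, v). u = v \<and> v = z0}"
  proof -
    \<comment> \<open>If block \<open>z0\<close> lies in \<open>A\<close> for both strings and every
      other block avoids \<open>A\<close> for both, then \<open>z0\<close> is the only candidate and
      both outputs equal it. Independence of the blocks gives the product.\<close>
    define E where "E z = (if z = z0 then {b. map fst b \<in> A \<and> map snd b \<in> A}
      else {b. map fst b \<notin> A \<and> map snd b \<notin> A})" for z
    have "measure_pmf.prob (replicate_pmf m ?p) (E z) = (if z = z0 then J else K)" for z
      unfolding E_def J_def K_def noisy_pair_def measure_map_pmf
      by (auto intro!: arg_cong[of _ _ "measure_pmf.prob _"])
    then have "measure_pmf.prob (Pi_pmf ?Z [] (\<lambda>_. replicate_pmf m ?p)) (Pi ?Z E)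
        = (\<Prod>z\<in>?Z. if z = z0 then J else K)"
      by (simp add: measure_Pi_pmf_Pi)
    also have "\<dots> = J * K ^ (2 ^ k - 1)"
      using Znz by (subst prod.remove[of _ z0]) (simp_all add: z0_def card_Diff_singleton)
    finally have "J * K ^ (2 ^ k - 1) = measure_pmf.prob (map_pmf fst \<Omega>) (Pi ?Z E)"
      by (simp add: \<Omega>_def map_fst_pair_pmf)
    also have "\<dots> \<le> measure_pmf.prob \<Omega> ((\<lambda>\<omega>. (F fst \<omega>, F snd \<omega>)) -` {(u, v). u = v \<and> v = z0})"
      unfolding measure_map_pmf
    proof (rule measure_pmf.finite_measure_mono_AE)
      have "F c \<omega> = z0" if "\<omega> \<in> set_pmf \<Omega>" "fst \<omega> \<in> Pi ?Z E" "c = fst \<or> c = snd" for \<omega> c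
        unfolding F_def
      proof (rule pick_shifted_singleton)
        show "map c (snd \<omega>) \<in> ?Z" using len(2)[OF that(1) Znz] by (simp add: bitstrings_def)
        have "map c (fst \<omega> z) \<in> A \<longleftrightarrow> z = z0" if "z \<in> ?Z" for z
          using Pi_mem[OF \<open>fst \<omega> \<in> Pi ?Z E\<close> that] \<open>c = fst \<or> c = snd\<close> by (auto simp: E_def split: if_splits)
        then show "{z \<in> ?Z. map c (fst \<omega> z) \<in> A} \<inter> ?Z = {z0}"
          using Znz by (auto simp: z0_def)
      qed
      then show "AE \<omega> in measure_pmf \<Omega>. \<omega> \<in> fst -` Pi ?Z E \<longrightarrow>
          \<omega> \<in> (\<lambda>\<omega>. (F fst \<omega>, F snd \<omega>)) -` {(u, v). u = v \<and> v = z0}"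
        by (simp add: AE_measure_pmf_iff)
    qed simp
    finally show ?thesis by (simp add: L_def)
  qed
  also have "\<dots> = M {(x, y). f x = f y} / 2 ^ k"
    using M_L[of "\<lambda>u v. u = v \<and> v = z0"] agree[of z0] Znz by (simp add: z0_def)
  finally have bound: "2 ^ k * J * K ^ (2 ^ k - 1) \<le> M {(x, y). f x = f y}"
    by (simp add: field_simps)
  have unif_fst: "M {(x, y). f x = z} = 1 / 2 ^ k" if "z \<in> ?Z" for z
    using unif[OF that, of "\<lambda>_ _. True"] by (simp add: M_def)
  have f_in: "f \<in> bitstrings n \<rightarrow> ?Z"
  proof
    fix x assume "x \<in> bitstrings n"
    then show "f x \<in> ?Z"
      unfolding f_def by (intro pick_shifted_in_bitstrings) (use n in \<open>simp add: bitstrings_def\<close>)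
  qed
  show ?thesis
    by (intro bexI[of _ f] conjI ballI unif_fst agree bound[unfolded J_def K_def] f_in)
qed

subsection \<open>Half spaces in the limit of long blocks\<close>

definition sgn_bit :: "bool \<Rightarrow> real" where
  "sgn_bit b = (if b then 1 else - 1)"

primrec sign_walk :: "nat \<Rightarrow> real pmf" where
  "sign_walk 0 = return_pmf 0"
| "sign_walk (Suc n) =
     do {b \<leftarrow> bernoulli_pmf (1/2); s \<leftarrow> sign_walk n; return_pmf (sgn_bit b + s)}"

lemma finite_set_sign_walk [simp]: "finite (set_pmf (sign_walk n))"
  by (induction n) auto

text \<open>The characteristic function is multiplicative over independent steps, and a single fair
  sign contributes \<open>cos u\<close>.\<close>

lemma expectation_iexp_sign_walk:
  "measure_pmf.expectation (sign_walk n) (\<lambda>s. iexp (u * s)) = complex_of_real (cos u ^ n)"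
proof (induction n)
  case (Suc n)
  let ?E = "measure_pmf.expectation (sign_walk n)"
  have *: "measure_pmf.expectation (sign_walk n \<bind> (\<lambda>s. return_pmf (a + s))) (\<lambda>s. iexp (u * s))
      = iexp (u * a) * complex_of_real (cos u ^ n)" for a
  proof -
    have "measure_pmf.expectation (sign_walk n \<bind> (\<lambda>s. return_pmf (a + s))) (\<lambda>s. iexp (u * s))
       = ?E (\<lambda>s. iexp (u * a) * iexp (u * s))"
      by (simp add: map_pmf_def[symmetric] distrib_left exp_add)
    also have "\<dots> = iexp (u * a) * ?E (\<lambda>s. iexp (u * s))"
      by simp
    finally show ?thesis by (simp only: Suc)
  qed
  have "measure_pmf.expectation (sign_walk (Suc n)) (\<lambda>s. iexp (u * s))
     = (\<Sum>b\<in>UNIV. pmf (bernoulli_pmf (1/2)) b *\<^sub>R (iexp (u * sgn_bit b) * complex_of_real (cos u ^ n)))"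
    unfolding sign_walk.simps
    by (subst pmf_expectation_bind[where A = UNIV]) (simp, simp, simp, simp only: *)
  also have "\<dots> = (iexp u + iexp (- u)) / 2 * complex_of_real (cos u ^ n)"
    by (simp add: UNIV_bool sgn_bit_def scaleR_conv_of_real field_simps)
  also have "(iexp u + iexp (- u)) / 2 = complex_of_real (cos u)"
    by (rule complex_eqI) (simp_all add: Re_exp Im_exp)
  finally show ?case by simp
qed simp

lemma cos_power_tendsto:
  "(\<lambda>n. cos (u / sqrt (real n)) ^ n) \<longlonglongrightarrow> exp (- (u\<^sup>2) / 2)"
proof -
  consider "u < 0" | "u = 0" | "u > 0" by linarith
  then show ?thesis by cases (real_asymp simp: power2_eq_square)+
qed

text \<open>By Levy's continuity theorem it suffices that \<open>cos (u / sqrt n) ^ n\<close> tends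
  to the Gaussian characteristic function.\<close>

lemma sign_walk_clt:
  "weak_conv_m (\<lambda>n. distr (measure_pmf (sign_walk n)) borel (\<lambda>s. s / sqrt (real n))) std_normal_distribution"
proof (rule levy_continuity)
  fix u
  have "char (distr (measure_pmf (sign_walk n)) borel (\<lambda>s. s / sqrt (real n))) u
      = complex_of_real (cos (u / sqrt (real n)) ^ n)" for n
    using expectation_iexp_sign_walk[of n "u / sqrt (real n)"]
    by (simp add: char_def integral_distr)
  moreover have "char std_normal_distribution u = complex_of_real (exp (- (u\<^sup>2) / 2))"
    by (simp add: char_std_normal_distribution)
  ultimately show "(\<lambda>n. char (distr (measure_pmf (sign_walk n)) borel (\<lambda>s. s / sqrt (real n))) u)
      \<longlonglongrightarrow> char std_normal_distribution u"
    using tendsto_of_real[OF cos_power_tendsto[of u]] by simp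
next
  show "real_distribution (distr (measure_pmf (sign_walk n)) borel (\<lambda>s. s / sqrt (real n)))" for n
    by (intro prob_space.real_distribution_distr) (auto intro: measure_pmf.prob_space_axioms)
qed (rule real_dist_normal_dist)

lemma isCont_cdf_std_normal: "isCont (cdf std_normal_distribution) x"
proof -
  interpret real_distribution std_normal_distribution by (rule real_dist_normal_dist)
  have "emeasure std_normal_distribution {x} = 0"
    by (subst emeasure_density) (auto intro!: nn_integral_null_delta simp: nn_integral_indicator_singleton)
  then show ?thesis by (simp add: isCont_cdf measure_def)
qed

lemma std_normal_tail_cdf: "measure std_normal_distribution {t<..} = 1 - cdf std_normal_distribution t"
proof -
  interpret real_distribution std_normal_distribution by (rule real_dist_normal_dist)
  have "{t<..} = space std_normal_distribution - {..t}" by auto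
  then show ?thesis using prob_compl[of "{..t}"] by (simp add: cdf_def)
qed

lemma cdf_sign_walk_tendsto:
  "(\<lambda>n. measure_pmf.prob (sign_walk n) {s. s \<le> x * sqrt n}) \<longlonglongrightarrow> cdf std_normal_distribution x"
proof -
  have "(\<lambda>n. cdf (distr (measure_pmf (sign_walk n)) borel (\<lambda>s. s / sqrt (real n))) x)
      \<longlonglongrightarrow> cdf std_normal_distribution x"
    using sign_walk_clt isCont_cdf_std_normal by (simp add: weak_conv_m_def weak_conv_def)
  moreover have "\<forall>\<^sub>F n in sequentially. cdf (distr (measure_pmf (sign_walk n)) borel (\<lambda>s. s / sqrt (real n))) x
      = measure_pmf.prob (sign_walk n) {s. s \<le> x * sqrt n}"
    using eventually_gt_at_top[of 0]
    by eventually_elim (auto simp: cdf_def measure_distr divide_le_eq intro!: arg_cong[of _ _ "measure_pmf.prob _"])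
  ultimately show ?thesis by (rule Lim_transform_eventually)
qed

lemma sign_walk_tail_tendsto:
  "(\<lambda>n. measure_pmf.prob (sign_walk n) {s. s > x * sqrt n}) \<longlonglongrightarrow> measure std_normal_distribution {x<..}"
proof -
  have "measure_pmf.prob (sign_walk n) {s. s > x * sqrt n} = 1 - measure_pmf.prob (sign_walk n) {s. s \<le> x * sqrt n}" for n
    by (subst measure_pmf.prob_compl[symmetric]) (auto intro!: arg_cong[of _ _ "measure_pmf.prob _"])
  then show ?thesis
    unfolding std_normal_tail_cdf by (simp add: tendsto_diff cdf_sign_walk_tendsto)
qed

text \<open>The half-open band makes the probability a difference of two values of the distribution
  function.\<close>

lemma sign_walk_band_tendsto:
  assumes "0 \<le> h"
  shows "(\<lambda>n. measure_pmf.prob (sign_walk n) {s. - h * sqrt n < s \<and> s \<le> h * sqrt n})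
    \<longlonglongrightarrow> cdf std_normal_distribution h - cdf std_normal_distribution (- h)"
proof -
  have "measure_pmf.prob (sign_walk n) {s. - h * sqrt n < s \<and> s \<le> h * sqrt n} =
    measure_pmf.prob (sign_walk n) {s. s \<le> h * sqrt n} - measure_pmf.prob (sign_walk n) {s. s \<le> - h * sqrt n}" for n
  proof -
    have "- h * sqrt n \<le> h * sqrt n" using assms by (simp add: mult_right_mono)
    then show ?thesis
      by (subst measure_pmf.finite_measure_Diff[symmetric]) (auto intro!: arg_cong[of _ _ "measure_pmf.prob _"])
  qed
  then show ?thesis by (simp only:) (intro tendsto_diff cdf_sign_walk_tendsto)
qed

section \<open>Decomposition of a noisy pair into two independent walks\<close>

lemma noisy_bit_pair_altdef:
  assumes "0 \<le> \<epsilon>" "\<epsilon> \<le> 1"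
  shows "noisy_bit_pair \<epsilon> = do {d \<leftarrow> bernoulli_pmf \<epsilon>; b \<leftarrow> bernoulli_pmf (1/2); return_pmf (b, b \<noteq> d)}"
proof (rule pmf_eqI)
  fix q :: "bool \<times> bool"
  show "pmf (noisy_bit_pair \<epsilon>) q =
    pmf (do {d \<leftarrow> bernoulli_pmf \<epsilon>; b \<leftarrow> bernoulli_pmf (1/2); return_pmf (b, b \<noteq> d)}) q"
    using assms by (cases q) (auto simp: pmf_noisy_bit_pair pmf_bind indicator_def)
qed

definition bit_sum :: "bool list \<Rightarrow> real" where
  "bit_sum x = (\<Sum>b\<leftarrow>x. sgn_bit b)"

definition half_space :: "real \<Rightarrow> nat \<Rightarrow> bool list set" where
  "half_space t m = {x. bit_sum x > t * sqrt m}"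

lemma map_bit_sum_replicate_pmf:
  assumes "map_pmf c p = bernoulli_pmf (1/2)"
  shows "map_pmf (\<lambda>ps. bit_sum (map c ps)) (replicate_pmf m p) = sign_walk m"
proof (induction m)
  case (Suc m)
  have "map_pmf (\<lambda>ps. bit_sum (map c ps)) (replicate_pmf (Suc m) p)
    = do {b \<leftarrow> map_pmf c p; s \<leftarrow> map_pmf (\<lambda>ps. bit_sum (map c ps)) (replicate_pmf m p); return_pmf (sgn_bit b + s)}"
    by (simp add: map_pmf_def bind_assoc_pmf bind_return_pmf bit_sum_def)
  then show ?case by (simp add: Suc assms)
qed (simp add: bit_sum_def)

text \<open>These are \<open>U\<close> and \<open>V\<close> of the overview: a position adds its
  sign to the half sum if the bits agree and to the half difference if they differ. The sign of the
  first bit is independent of whether they differ, so given \<open>d\<close> disagreements two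
  independent walks of \<open>m - d\<close> and \<open>d\<close> steps remain.\<close>

lemma map_half_sums_replicate_pmf:
  assumes \<epsilon>: "0 \<le> \<epsilon>" "\<epsilon> \<le> 1"
  shows "map_pmf (\<lambda>ps. ((bit_sum (map fst ps) + bit_sum (map snd ps)) / 2,
      (bit_sum (map fst ps) - bit_sum (map snd ps)) / 2)) (replicate_pmf m (noisy_bit_pair \<epsilon>))
    = binomial_pmf m \<epsilon> \<bind> (\<lambda>d. pair_pmf (sign_walk (m - d)) (sign_walk d))"
    (is "map_pmf ?h _ = _")
proof (induction m)
  case 0
  then show ?case using \<epsilon> by (simp add: bit_sum_def binomial_pmf_0 bind_return_pmf pair_return_pmf1)
next
  case (Suc m)
  define h where "h = ?h"
  have h: "h ((b, b \<longleftrightarrow> \<not> d) # ps) = (case h ps of (u, v) \<Rightarrow>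
      if d then (u, sgn_bit b + v) else (sgn_bit b + u, v))" for b d ps
    by (auto simp: h_def bit_sum_def sgn_bit_def field_simps)
  have "map_pmf ?h (replicate_pmf (Suc m) (noisy_bit_pair \<epsilon>)) =
    do {d \<leftarrow> bernoulli_pmf \<epsilon>; b \<leftarrow> bernoulli_pmf (1/2);
        (u, v) \<leftarrow> map_pmf ?h (replicate_pmf m (noisy_bit_pair \<epsilon>));
        return_pmf (if d then (u, sgn_bit b + v) else (sgn_bit b + u, v))}"
    unfolding replicate_pmf.simps h_def[symmetric]
    by (subst noisy_bit_pair_altdef[OF \<epsilon>])
      (simp add: map_pmf_def bind_assoc_pmf bind_return_pmf h split_beta if_distrib)
  also have "\<dots> = do {d \<leftarrow> bernoulli_pmf \<epsilon>; j \<leftarrow> binomial_pmf m \<epsilon>; b \<leftarrow> bernoulli_pmf (1/2);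
        u \<leftarrow> sign_walk (m - j); v \<leftarrow> sign_walk j;
        return_pmf (if d then (u, sgn_bit b + v) else (sgn_bit b + u, v))}"
    unfolding Suc
    by (simp add: pair_pmf_def bind_assoc_pmf bind_return_pmf
        bind_commute_pmf[of "bernoulli_pmf (1/2)" "binomial_pmf m \<epsilon>"])
  also have "\<dots> = do {d \<leftarrow> bernoulli_pmf \<epsilon>; j \<leftarrow> binomial_pmf m \<epsilon>;
        pair_pmf (sign_walk (Suc m - ((if d then 1 else 0) + j))) (sign_walk ((if d then 1 else 0) + j))}"
  proof (intro bind_pmf_cong refl)
    \<comment> \<open>The support of the binomial gives \<open>j \<le> m\<close>, so the truncated
      subtraction is exact.\<close>
    fix d j assume "j \<in> set_pmf (binomial_pmf m \<epsilon>)"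
    then have j: "Suc m - j = Suc (m - j)"
      using \<epsilon> set_pmf_binomial_eq[of \<epsilon> m] by (auto split: if_splits)
    show "do {b \<leftarrow> bernoulli_pmf (1/2); u \<leftarrow> sign_walk (m - j); v \<leftarrow> sign_walk j;
        return_pmf (if d then (u, sgn_bit b + v) else (sgn_bit b + u, v))} =
      pair_pmf (sign_walk (Suc m - ((if d then 1 else 0) + j))) (sign_walk ((if d then 1 else 0) + j))"
      by (cases d) (simp_all add: j pair_pmf_def bind_assoc_pmf bind_return_pmf
        bind_commute_pmf[of "bernoulli_pmf (1/2)" "sign_walk (m - j)"])
  qed
  also have "\<dots> = binomial_pmf (Suc m) \<epsilon> \<bind> (\<lambda>d. pair_pmf (sign_walk (Suc m - d)) (sign_walk d))"
    using \<epsilon> by (simp add: binomial_pmf_Suc bind_assoc_pmf bind_return_pmf)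
  finally show ?case .
qed

text \<open>The law of total probability, keeping only the draws in \<open>G\<close>.\<close>

lemma measure_bind_pmf_ge:
  assumes "\<And>d. d \<in> G \<Longrightarrow> c \<le> measure_pmf.prob (N d) E" "0 \<le> c"
  shows "c * measure_pmf.prob M G \<le> measure_pmf.prob (bind_pmf M N) E"
proof -
  have "ennreal (c * measure_pmf.prob M G) = (\<integral>\<^sup>+d. ennreal c * indicator G d \<partial>M)"
    using assms(2) by (simp add: nn_integral_cmult_indicator measure_pmf.emeasure_eq_measure ennreal_mult)
  also have "\<dots> \<le> (\<integral>\<^sup>+d. emeasure (N d) E \<partial>M)"
    using assms(1) by (intro nn_integral_mono) (auto simp: indicator_def measure_pmf.emeasure_eq_measure)
  also have "\<dots> = ennreal (measure_pmf.prob (bind_pmf M N) E)"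
    by (simp flip: measure_pmf.emeasure_eq_measure)
  finally show ?thesis by simp
qed

lemma map_fst_noisy_bit_pair:
  assumes "0 \<le> \<epsilon>" "\<epsilon> \<le> 1"
  shows "map_pmf fst (noisy_bit_pair \<epsilon>) = bernoulli_pmf (1/2)"
  by (simp add: noisy_bit_pair_altdef[OF assms] map_pmf_def bind_assoc_pmf bind_return_pmf bind_return_pmf')

lemma map_snd_noisy_bit_pair:
  assumes "0 \<le> \<epsilon>" "\<epsilon> \<le> 1"
  shows "map_pmf snd (noisy_bit_pair \<epsilon>) = bernoulli_pmf (1/2)"
proof -
  have flip: "map_pmf (\<lambda>b. b \<longleftrightarrow> \<not> d) (bernoulli_pmf (1/2)) = bernoulli_pmf (1/2)" for d
    by (cases d) (rule pmf_eqI, simp add: map_pmf_def pmf_bind indicator_def)+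
  have "map_pmf snd (noisy_bit_pair \<epsilon>) =
      bernoulli_pmf \<epsilon> \<bind> (\<lambda>d. map_pmf (\<lambda>b. b \<noteq> d) (bernoulli_pmf (1/2)))"
    unfolding noisy_bit_pair_altdef[OF assms] by (simp add: map_pmf_def bind_assoc_pmf bind_return_pmf)
  then show ?thesis by (simp add: flip)
qed

text \<open>A union bound: the bit sum of each string alone is a simple random walk.\<close>

lemma half_space_marginals:
  fixes \<epsilon> t :: real and m :: nat
  assumes "0 \<le> \<epsilon>" "\<epsilon> \<le> 1"
  defines "P \<equiv> measure_pmf.prob (noisy_pair m \<epsilon>)"
    and "q \<equiv> measure_pmf.prob (sign_walk m) {s. s > t * sqrt m}"
  shows "P ((- half_space t m) \<times> (- half_space t m)) \<ge> 1 - 2 * q"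
proof -
  let ?r = "replicate_pmf m (noisy_bit_pair \<epsilon>)" and ?A = "half_space t m"
  have q: "measure_pmf.prob ?r {ps. map c ps \<in> ?A} = q" if "map_pmf c (noisy_bit_pair \<epsilon>) = bernoulli_pmf (1/2)" for c
    unfolding q_def map_bit_sum_replicate_pmf[OF that, symmetric] measure_map_pmf
    by (intro arg_cong[of _ _ "measure_pmf.prob _"]) (auto simp: half_space_def)
  have "P ((- ?A) \<times> (- ?A)) = measure_pmf.prob ?r (UNIV - ({ps. map fst ps \<in> ?A} \<union> {ps. map snd ps \<in> ?A}))"
    unfolding P_def noisy_pair_def measure_map_pmf by (intro arg_cong[of _ _ "measure_pmf.prob _"]) auto
  also have "\<dots> = 1 - measure_pmf.prob ?r ({ps. map fst ps \<in> ?A} \<union> {ps. map snd ps \<in> ?A})"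
    using measure_pmf.prob_compl[of _ ?r] by simp
  finally have "P ((- ?A) \<times> (- ?A))
      = 1 - measure_pmf.prob ?r ({ps. map fst ps \<in> ?A} \<union> {ps. map snd ps \<in> ?A})" .
  moreover have "measure_pmf.prob ?r ({ps. map fst ps \<in> ?A} \<union> {ps. map snd ps \<in> ?A}) \<le> q + q"
    using measure_Un_le[of "{ps. map fst ps \<in> ?A}" ?r "{ps. map snd ps \<in> ?A}"]
    by (simp add: q[OF map_fst_noisy_bit_pair] q[OF map_snd_noisy_bit_pair] assms)
  ultimately show ?thesis by simp
qed

text \<open>If \<open>u > (t + s) * sqrt m\<close> and \<open>v\<close> is at most
  \<open>s * sqrt m\<close> in absolute value, then both \<open>u + v\<close> and
  \<open>u - v\<close> exceed \<open>t * sqrt m\<close>. The set \<open>G\<close> is meant to hold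
  the typical numbers of disagreements.\<close>

lemma half_space_joint_ge:
  fixes \<epsilon> t s c :: real and m :: nat
  assumes \<epsilon>: "0 \<le> \<epsilon>" "\<epsilon> \<le> 1" and c: "0 \<le> c"
    and G: "\<And>d. d \<in> G \<Longrightarrow> c \<le> measure_pmf.prob (sign_walk (m - d)) {u. u > (t + s) * sqrt m} *
      measure_pmf.prob (sign_walk d) {v. - (s * sqrt m) \<le> v \<and> v \<le> s * sqrt m}"
  shows "c * measure_pmf.prob (binomial_pmf m \<epsilon>) G
    \<le> measure_pmf.prob (noisy_pair m \<epsilon>) (half_space t m \<times> half_space t m)"
proof -
  let ?E = "{u. u > (t + s) * sqrt m} \<times> {v. - (s * sqrt m) \<le> v \<and> v \<le> s * sqrt m}"
  let ?h = "\<lambda>ps. ((bit_sum (map fst ps) + bit_sum (map snd ps)) / 2,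
      (bit_sum (map fst ps) - bit_sum (map snd ps)) / 2)"
  \<comment> \<open>Intersecting with the finite supports yields countable sets, to which the
    product rule applies.\<close>
  have prod: "measure_pmf.prob (pair_pmf (M :: real pmf) N) (A \<times> B) = measure_pmf.prob M A * measure_pmf.prob N B"
    if "finite (set_pmf M)" "finite (set_pmf N)" for M N A B
  proof -
    have "measure_pmf.prob (pair_pmf M N) (A \<times> B)
        = measure_pmf.prob (pair_pmf M N) ((A \<inter> set_pmf M) \<times> (B \<inter> set_pmf N))"
      by (intro measure_pmf.finite_measure_eq_AE) (auto simp: AE_measure_pmf_iff)
    also have "\<dots> = measure_pmf.prob M (A \<inter> set_pmf M) * measure_pmf.prob N (B \<inter> set_pmf N)"
      using that by (intro measure_pmf_prob_product) (auto intro: countable_finite)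
    finally show ?thesis by (simp add: measure_Int_set_pmf)
  qed
  have "c * measure_pmf.prob (binomial_pmf m \<epsilon>) G
      \<le> measure_pmf.prob (binomial_pmf m \<epsilon> \<bind> (\<lambda>d. pair_pmf (sign_walk (m - d)) (sign_walk d))) ?E"
    by (rule measure_bind_pmf_ge) (use G c in \<open>simp_all add: prod\<close>)
  also have "\<dots> = measure_pmf.prob (replicate_pmf m (noisy_bit_pair \<epsilon>)) (?h -` ?E)"
    unfolding map_half_sums_replicate_pmf[OF \<epsilon>, symmetric] measure_map_pmf ..
  also have "\<dots> \<le> measure_pmf.prob (noisy_pair m \<epsilon>) (half_space t m \<times> half_space t m)"
    unfolding noisy_pair_def measure_map_pmf
    by (rule measure_pmf.finite_measure_mono) (auto simp: half_space_def distrib_right)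
  finally show ?thesis .
qed

section \<open>Passing to the limit in the joint probability\<close>

text \<open>Hoeffding's inequality makes the complement exponentially unlikely.\<close>

lemma binomial_band_tendsto:
  assumes "0 \<le> p" "p \<le> 1" "0 < \<delta>"
  shows "(\<lambda>m. measure_pmf.prob (binomial_pmf m p) {d. \<bar>real d / real m - p\<bar> < \<delta>}) \<longlonglongrightarrow> 1"
proof (rule tendsto_sandwich)
  interpret binomial_distribution m p for m by unfold_locales (use assms in auto)
  show "\<forall>\<^sub>F m in sequentially. 1 - 2 * exp (- 2 * real m * \<delta>\<^sup>2) \<le>
      measure_pmf.prob (binomial_pmf m p) {d. \<bar>real d / real m - p\<bar> < \<delta>}"
    using eventually_gt_at_top[of 0]
  proof eventually_elim
    case (elim m)
    have "{d. \<bar>real d / real m - p\<bar> < \<delta>} = UNIV - {d. \<bar>real d / real m - p\<bar> \<ge> \<delta>}" by auto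
    then have "measure_pmf.prob (binomial_pmf m p) {d. \<bar>real d / real m - p\<bar> < \<delta>}
        = 1 - measure_pmf.prob (binomial_pmf m p) {d. \<bar>real d / real m - p\<bar> \<ge> \<delta>}"
      using measure_pmf.prob_compl[of _ "binomial_pmf m p"] by simp
    then show ?case using prob_abs_ge'[OF elim, of \<delta>] assms by simp
  qed
  show "(\<lambda>m. 1 - 2 * exp (- 2 * real m * \<delta>\<^sup>2)) \<longlonglongrightarrow> 1"
    using assms(3) by real_asymp
  show "\<forall>\<^sub>F m in sequentially. measure_pmf.prob (binomial_pmf m p) {d. \<bar>real d / real m - p\<bar> < \<delta>} \<le> 1"
    by simp
qed (rule tendsto_const)

text \<open>The bound on \<gamma> is the Gaussian limit of the product of the two walk probabilities
  at disagreement rate \<epsilon>. Its strictness absorbs the fluctuation of that rate and the error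
  of the central limit theorem.\<close>

lemma eventually_half_space_joint:
  fixes \<epsilon> t s \<gamma> :: real
  defines "\<Phi> \<equiv> cdf std_normal_distribution"
  assumes \<epsilon>: "0 < \<epsilon>" "\<epsilon> < 1" and "0 \<le> t" "0 < s" and \<gamma>0: "0 \<le> \<gamma>"
    and \<gamma>: "\<gamma> < (1 - \<Phi> ((t + s) / sqrt (1 - \<epsilon>))) * (\<Phi> (s / sqrt \<epsilon>) - \<Phi> (- (s / sqrt \<epsilon>)))"
  shows "\<forall>\<^sub>F m in sequentially. \<gamma> \<le> measure_pmf.prob (noisy_pair m \<epsilon>) (half_space t m \<times> half_space t m)"
proof -
  \<comment> \<open>The Gaussian product as a function of the disagreement rate. By continuity it
    still exceeds \<gamma> at some rate \<open>e\<close> slightly above \<epsilon>.\<close>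
  define g where "g e = (1 - \<Phi> ((t + s) / sqrt (1 - e))) * (\<Phi> (s / sqrt e) - \<Phi> (- (s / sqrt e)))" for e
  have "isCont (\<lambda>e. (t + s) / sqrt (1 - e)) \<epsilon>" "isCont (\<lambda>e. s / sqrt e) \<epsilon>" "isCont (\<lambda>e. - (s / sqrt e)) \<epsilon>"
    using \<epsilon> by (auto intro!: continuous_intros)
  then have "isCont g \<epsilon>"
    unfolding g_def \<Phi>_def
    by (intro continuous_intros isCont_o2[OF _ isCont_cdf_std_normal]) (use \<epsilon> in auto)
  then have "(g \<longlongrightarrow> g \<epsilon>) (at_right \<epsilon>)"
    by (simp add: isCont_def filterlim_at_split)
  then have "\<forall>\<^sub>F e in at_right \<epsilon>. \<gamma> < g e"
    by (rule order_tendstoD) (use \<gamma> in \<open>simp add: g_def\<close>)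
  moreover have "\<forall>\<^sub>F e in at_right \<epsilon>. e \<in> {\<epsilon><..<1}"
    using \<epsilon> eventually_at_right_real by blast
  ultimately have "\<forall>\<^sub>F e in at_right \<epsilon>. \<gamma> < g e \<and> \<epsilon> < e \<and> e < 1"
    by eventually_elim auto
  then obtain e where e: "\<gamma> < g e" "\<epsilon> < e" "e < 1"
    using eventually_happens'[of "at_right \<epsilon>"] by auto
  \<comment> \<open>The number of disagreements is at most \<open>e * m\<close> with probability tending to 1, so \<open>U\<close> and \<open>V\<close>
    are compared with walks of \<open>(1 - e) * m\<close> and \<open>e * m\<close> steps.\<close>
  obtain c where c: "\<gamma> < c" "c < g e" using dense[OF e(1)] by blast
  let ?\<tau> = "(t + s) / sqrt (1 - e)" and ?h = "s / sqrt e"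
  define a where "a j = measure_pmf.prob (sign_walk j) {u. u > ?\<tau> * sqrt j}" for j
  define b where "b j = measure_pmf.prob (sign_walk j) {v. - ?h * sqrt j < v \<and> v \<le> ?h * sqrt j}" for j
  have "a \<longlonglongrightarrow> 1 - \<Phi> ?\<tau>" unfolding a_def \<Phi>_def std_normal_tail_cdf[symmetric] by (rule sign_walk_tail_tendsto)
  moreover have "b \<longlonglongrightarrow> \<Phi> ?h - \<Phi> (- ?h)"
    unfolding b_def \<Phi>_def by (rule sign_walk_band_tendsto) (use \<epsilon> e \<open>0 < s\<close> in auto)
  ultimately have "((\<lambda>(i, j). a i * b j) \<longlongrightarrow> g e) (sequentially \<times>\<^sub>F sequentially)"
    unfolding g_def case_prod_unfold
    by (intro tendsto_mult) (auto intro: filterlim_compose filterlim_fst filterlim_snd)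
  then have "\<forall>\<^sub>F x in sequentially \<times>\<^sub>F sequentially. c < (case x of (i, j) \<Rightarrow> a i * b j)"
    by (rule order_tendstoD) (rule c)
  then obtain n0 where n0: "\<And>i j. n0 \<le> i \<Longrightarrow> n0 \<le> j \<Longrightarrow> c < a i * b j"
    unfolding eventually_prod_sequentially by auto
  \<comment> \<open>The bound \<open>e - \<epsilon>\<close> keeps \<open>d\<close> below
    \<open>e * m\<close>; the bound \<open>\<epsilon> / 2\<close> forces \<open>d\<close> to grow
    with \<open>m\<close>, as the limit theorem for \<open>V\<close> requires.\<close>
  define \<delta> where "\<delta> = min (\<epsilon> / 2) (e - \<epsilon>)"
  define G where "G m = {d. \<bar>real d / real m - \<epsilon>\<bar> < \<delta>}" for m :: nat
  have \<delta>: "0 < \<delta>" using \<epsilon> e by (simp add: \<delta>_def)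
  have "(\<lambda>m. c * measure_pmf.prob (binomial_pmf m \<epsilon>) (G m)) \<longlonglongrightarrow> c * 1"
    unfolding G_def by (intro tendsto_mult tendsto_const binomial_band_tendsto) (use \<epsilon> \<delta> in auto)
  then have "\<forall>\<^sub>F m in sequentially. \<gamma> < c * measure_pmf.prob (binomial_pmf m \<epsilon>) (G m)"
    by (rule order_tendstoD) (use c in simp)
  moreover have "\<forall>\<^sub>F m in sequentially. real n0 \<le> \<epsilon> / 2 * real m"
    using \<epsilon> by real_asymp
  moreover have "\<forall>\<^sub>F m in sequentially. real n0 \<le> (1 - e) * real m"
    using e by real_asymp
  ultimately show ?thesis
    using eventually_gt_at_top[of 0]
  proof eventually_elim
    case (elim m)
    have "c * measure_pmf.prob (binomial_pmf m \<epsilon>) (G m)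
      \<le> measure_pmf.prob (noisy_pair m \<epsilon>) (half_space t m \<times> half_space t m)"
    proof (rule half_space_joint_ge)
      fix d assume "d \<in> G m"
      then have "\<bar>real d / real m - \<epsilon>\<bar> < \<delta>" by (simp add: G_def)
      then have "real d / real m < e" "\<epsilon> / 2 < real d / real m"
        unfolding \<delta>_def by linarith+
      then have d: "real d < e * real m" "\<epsilon> / 2 * real m < real d"
        using elim by (auto simp: field_simps)
      have "e * real m < 1 * real m" using e elim by (intro mult_strict_right_mono) auto
      then have dm: "d \<le> m" using d by simp
      have md: "(1 - e) * real m \<le> real (m - d)" using d dm by (simp add: of_nat_diff algebra_simps)
      have "c < a (m - d) * b d"
      proof (rule n0)
        have "real n0 \<le> real (m - d)" "real n0 \<le> real d" using elim md d by linarith+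
        then show "n0 \<le> m - d" "n0 \<le> d" by simp_all
      qed
      \<comment> \<open>Since \<open>m - d \<ge> (1 - e) * m\<close>, the threshold in
        \<open>a\<close> is at least \<open>(t + s) * sqrt m\<close>. Since
        \<open>d < e * m\<close>, the band in \<open>b\<close> lies inside the required one.\<close>
      also have "\<dots> \<le> measure_pmf.prob (sign_walk (m - d)) {u. u > (t + s) * sqrt m} *
          measure_pmf.prob (sign_walk d) {v. - (s * sqrt m) \<le> v \<and> v \<le> s * sqrt m}"
      proof (rule mult_mono)
        have "sqrt ((1 - e) * real m) \<le> sqrt (real (m - d))" using md by simp
        then have "(t + s) * sqrt m \<le> ?\<tau> * sqrt (real (m - d))"
          using e \<open>0 \<le> t\<close> \<open>0 < s\<close>
          by (simp add: real_sqrt_mult pos_le_divide_eq mult_left_mono mult.assoc mult.commute[of _ "sqrt (1 - e)"])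
        then show "a (m - d) \<le> measure_pmf.prob (sign_walk (m - d)) {u. u > (t + s) * sqrt m}"
          unfolding a_def by (intro measure_pmf.finite_measure_mono) auto
        have "sqrt (real d) \<le> sqrt (e * real m)" using d by simp
        then have "?h * sqrt (real d) \<le> s * sqrt m"
          using e \<epsilon> \<open>0 < s\<close>
          by (simp add: real_sqrt_mult pos_divide_le_eq mult_left_mono mult.assoc mult.commute[of _ "sqrt e"])
        then show "b d \<le> measure_pmf.prob (sign_walk d) {v. - (s * sqrt m) \<le> v \<and> v \<le> s * sqrt m}"
          unfolding b_def by (intro measure_pmf.finite_measure_mono) auto
      qed (auto simp: b_def)
      finally show "c \<le> \<dots>" by simp
    qed (use \<epsilon> c \<gamma>0 in auto)
    then show ?case using elim by linarith
  qed
qed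

subsection \<open>Gaussian estimates\<close>

lemma std_normal_interval_ge:
  assumes "a < b" "0 \<le> c" "\<And>x. a < x \<Longrightarrow> x \<le> b \<Longrightarrow> c \<le> std_normal_density x"
  shows "(b - a) * c \<le> cdf std_normal_distribution b - cdf std_normal_distribution a"
proof -
  interpret real_distribution std_normal_distribution by (rule real_dist_normal_dist)
  have "ennreal ((b - a) * c) = (\<integral>\<^sup>+x. ennreal c * indicator {a<..b} x \<partial>lborel)"
    using assms by (simp add: nn_integral_cmult_indicator ennreal_mult mult.commute)
  also have "\<dots> \<le> (\<integral>\<^sup>+x. ennreal (std_normal_density x) * indicator {a<..b} x \<partial>lborel)"
    using assms(3) by (intro nn_integral_mono) (auto simp: indicator_def)
  also have "\<dots> = emeasure std_normal_distribution {a<..b}"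
    by (subst emeasure_density) auto
  also have "\<dots> = ennreal (cdf std_normal_distribution b - cdf std_normal_distribution a)"
    by (simp add: emeasure_eq_measure cdf_diff_eq[OF assms(1)])
  finally show ?thesis by (simp add: ennreal_le_iff cdf_nondecreasing assms(1) less_imp_le)
qed

text \<open>The Mills ratio bound: beyond \<open>t\<close> the density is at most
  \<open>x / t\<close> times itself, which has the antiderivative
  \<open>- (std_normal_density x / t)\<close>.\<close>

lemma std_normal_tail_le:
  assumes "0 < t"
  shows "measure std_normal_distribution {t<..} \<le> std_normal_density t / t"
proof -
  interpret real_distribution std_normal_distribution by (rule real_dist_normal_dist)
  have "ennreal (measure std_normal_distribution {t<..})
      = (\<integral>\<^sup>+x. ennreal (std_normal_density x) * indicator {t<..} x \<partial>lborel)"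
    by (subst emeasure_density[symmetric]) (auto simp: emeasure_eq_measure)
  also have "\<dots> \<le> (\<integral>\<^sup>+x. ennreal (x / t * std_normal_density x) * indicator {t..} x \<partial>lborel)"
  proof (intro nn_integral_mono)
    fix x
    have "1 * std_normal_density x \<le> x / t * std_normal_density x" if "t < x"
      using that assms by (intro mult_right_mono) auto
    then show "ennreal (std_normal_density x) * indicator {t<..} x
        \<le> ennreal (x / t * std_normal_density x) * indicator {t..} x"
      by (auto simp: indicator_def intro!: ennreal_leI)
  qed
  also have "\<dots> = ennreal (0 - (- (std_normal_density t / t)))"
  proof (rule nn_integral_FTC_atLeast[where F = "\<lambda>x. - (std_normal_density x / t)"])
    show "((\<lambda>x. - (std_normal_density x / t)) has_real_derivative x / t * std_normal_density x) (at x)"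
      if "t \<le> x" for x
      unfolding std_normal_density_def using assms
      by (auto intro!: derivative_eq_intros simp: field_simps power2_eq_square)
    show "((\<lambda>x. - (std_normal_density x / t)) \<longlongrightarrow> 0) at_top"
      unfolding std_normal_density_def using assms by real_asymp
  qed (use assms in auto)
  finally show ?thesis using assms by (simp add: ennreal_le_iff)
qed

section \<open>Explicit constants\<close>

text \<open>With \<open>M = N - 1\<close>, the base is the reciprocal of \<open>1 + 1 / M\<close>,
  which is at most \<open>exp (1 / M)\<close>. This bounds the cost of the other
  \<open>N - 1\<close> blocks missing \<open>A\<close>.\<close>

lemma exp_minus_one_le_power:
  assumes "2 \<le> (N::nat)"
  shows "exp (- 1) \<le> (1 - 1 / real N) ^ (N - 1)"
proof -
  define M where "M = N - 1"
  have N: "real N = real M + 1" "0 < real M" using assms by (auto simp: M_def)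
  have "1 + 1 / real M \<le> exp (1 / real M)" by (rule exp_ge_add_one_self)
  then have "exp (- (1 / real M)) \<le> 1 - 1 / real N"
    using N by (simp add: exp_minus field_simps)
  then have "exp (- (1 / real M)) ^ M \<le> (1 - 1 / real N) ^ M"
    by (intro power_mono) auto
  moreover have "exp (- (1 / real M)) ^ M = exp (- 1)"
    using N by (simp flip: exp_of_nat_mult)
  ultimately show ?thesis by (simp add: M_def)
qed

lemma exp_one_le: "exp (1 :: real) \<le> 272 / 100"
  using e_less_272 by simp

lemma sqrt_two_pi_bounds: "2 < sqrt (2 * pi)" "sqrt (2 * pi) < 283 / 100"
proof -
  show "2 < sqrt (2 * pi)" using pi_gt3 by (intro real_less_rsqrt) simp
  show "sqrt (2 * pi) < 283 / 100" using pi_less_4 by (intro real_less_lsqrt) (simp_all add: power2_eq_square)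
qed

text \<open>Setting the Mills bound, not the tail itself, equal to \<open>1 / (2 * 2 ^ k)\<close>
  bounds the tail and also gives an exact formula for \<open>exp (- t\<^sup>2 / 2)\<close>. The
  solution comes from the intermediate value theorem.\<close>

lemma exists_threshold:
  fixes k :: nat
  assumes k: "10 \<le> k"
  obtains t where "sqrt k \<le> t" "t \<le> 6 / 5 * sqrt k" "std_normal_density t / t = 1 / (2 * 2 ^ k)"
proof -
  define g where "g u = 2 * 2 ^ k * std_normal_density u - u" for u
  \<comment> \<open>The base is chosen so that \<open>147 / 100 * exp 1 \<le> 4\<close>.\<close>
  have "2 * real n \<le> (147 / 100) ^ n" if "10 \<le> n" for n :: nat
    using that
  proof (induction n rule: nat_induct_at_least)
    case (Suc n)
    then have "2 * real (Suc n) \<le> 147 / 100 * (2 * real n)" by simp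
    also have "\<dots> \<le> 147 / 100 * (147 / 100) ^ n" using Suc by simp
    finally show ?case by simp
  qed (simp add: eval_nat_numeral)
  from this[OF k] have "2 * real k * exp 1 ^ k \<le> (147 / 100 * exp 1) ^ k"
    unfolding power_mult_distrib by (rule mult_right_mono) simp
  also have "\<dots> \<le> 4 ^ k"
    using exp_one_le by (intro power_mono) auto
  finally have 4: "2 * real k * exp (real k) \<le> 4 ^ k"
    by (simp flip: exp_of_nat_mult)
  have "(sqrt k * (sqrt (2 * pi) * exp (real k / 2)))\<^sup>2 = real k * (2 * pi) * exp (real k)"
    by (simp add: power_mult_distrib flip: exp_double)
  also have "\<dots> \<le> real k * 8 * exp (real k)"
    using pi_less_4 by (intro mult_mono) auto
  also have "\<dots> \<le> (2 * 2 ^ k)\<^sup>2"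
  proof -
    have "(2 ^ k)\<^sup>2 = (4 :: real) ^ k" by (simp add: power2_eq_square flip: power_mult_distrib)
    then show ?thesis using 4 by (simp add: power_mult_distrib)
  qed
  finally have "sqrt k * (sqrt (2 * pi) * exp (real k / 2)) \<le> 2 * 2 ^ k"
    by (rule power2_le_imp_le) simp
  then have g1: "0 \<le> g (sqrt k)"
    by (simp add: g_def std_normal_density_def exp_minus field_simps)
  \<comment> \<open>\<open>18 / 25\<close> is half the square of \<open>6 / 5\<close>, so the
    density at the right endpoint beats \<open>2 ^ k\<close>.\<close>
  have "ln 2 \<le> (18 / 25 :: real)" using ln2_le_25_over_36 by simp
  then have "exp (ln 2) ^ k \<le> exp (18 / 25 :: real) ^ k"
    by (intro power_mono) (simp_all only: exp_le_cancel_iff exp_ge_zero)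
  then have "2 ^ k \<le> exp (18 / 25 * real k)"
    by (simp add: exp_of_nat_mult[symmetric] mult.commute)
  then have "2 * 2 ^ k * std_normal_density (6 / 5 * sqrt k) \<le> 2 / sqrt (2 * pi)"
    by (simp add: std_normal_density_def exp_minus power_mult_distrib field_simps)
  also have "\<dots> \<le> 1" using sqrt_two_pi_bounds by (simp add: field_simps)
  also have "1 \<le> sqrt k" using k by simp
  then have "1 \<le> 6 / 5 * sqrt k" by linarith
  finally have g2: "g (6 / 5 * sqrt k) \<le> 0" by (simp add: g_def)
  have "\<exists>t. sqrt k \<le> t \<and> t \<le> 6 / 5 * sqrt k \<and> g t = 0"
    by (rule IVT2') (use g1 g2 in \<open>auto simp: g_def std_normal_density_def intro!: continuous_intros\<close>)
  then obtain t where t: "sqrt k \<le> t" "t \<le> 6 / 5 * sqrt k" "g t = 0" by blast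
  moreover have "0 < t" using t(1) k by (metis less_le_trans of_nat_0_less_iff real_sqrt_gt_zero zero_less_numeral)
  ultimately show ?thesis
    by (intro that[of t]) (simp_all add: g_def field_simps)
qed

text \<open>\<open>7 / 2\<close> bounds the total constant loss \<open>3 + \<delta>\<close> in the
  exponent of the final estimate.\<close>

lemma exp_minus_seven_halves_ge: "exp (- (7 / 2)) \<ge> (3 / 100 :: real)"
proof -
  have "(exp (7 / 2 :: real))\<^sup>2 = exp 1 ^ 7"
    by (simp flip: exp_double exp_of_nat_mult)
  also have "\<dots> \<le> (272 / 100) ^ 7"
    using exp_one_le by (intro power_mono) auto
  also have "\<dots> \<le> (100 / 3)\<^sup>2" by (simp add: eval_nat_numeral)
  finally have "exp (7 / 2 :: real) \<le> 100 / 3" by (rule power2_le_imp_le) simp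
  then show ?thesis by (simp add: exp_minus field_simps)
qed

text \<open>Keeps the constant uniform as \<epsilon> approaches 1. With
  \<open>y = \<epsilon> / (1 - \<epsilon>)\<close>, the squared right side is
  \<open>exp (2 * y) / (1 + y) ^ 3\<close>; cubing
  \<open>2 / 3 * (1 + y) \<le> exp (2 / 3 * y)\<close> bounds it below by \<open>8 / 27\<close>,
  more than \<open>1 / 4\<close>.\<close>

lemma exp_ratio_bound:
  assumes "0 < \<epsilon>" "\<epsilon> < 1"
  shows "1 / 2 \<le> exp (\<epsilon> / (1 - \<epsilon>)) * ((1 - \<epsilon>) * sqrt (1 - \<epsilon>))"
proof (rule power2_le_imp_le)
  define y where "y = \<epsilon> / (1 - \<epsilon>)"
  have y: "0 < y" "1 - \<epsilon> = 1 / (1 + y)" using assms by (auto simp: y_def field_simps)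
  have "2 / 3 * (1 + y) \<le> exp (2 / 3 * y)"
    using exp_ge_add_one_self[of "2 / 3 * y"] by (simp add: field_simps)
  then have "(2 / 3 * (1 + y)) ^ 3 \<le> exp (2 / 3 * y) ^ 3"
    using y by (intro power_mono) auto
  also have "\<dots> = (exp y)\<^sup>2" by (simp flip: exp_double exp_of_nat_mult)
  finally have "8 / 27 * (1 + y) ^ 3 \<le> (exp y)\<^sup>2"
    by (simp only: power_mult_distrib) (simp add: eval_nat_numeral)
  then have "8 / 27 * (1 + y) ^ 3 * (1 - \<epsilon>) ^ 3 \<le> (exp y)\<^sup>2 * (1 - \<epsilon>) ^ 3"
    using assms by (intro mult_right_mono) auto
  moreover have "(1 + y) ^ 3 * (1 - \<epsilon>) ^ 3 = 1"
    using y by (simp flip: power_mult_distrib)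
  ultimately have "8 / 27 \<le> (exp y)\<^sup>2 * (1 - \<epsilon>) ^ 3" by (simp add: mult.assoc)
  also have "\<dots> = (exp y * ((1 - \<epsilon>) * sqrt (1 - \<epsilon>)))\<^sup>2"
    using assms by (simp add: power_mult_distrib eval_nat_numeral)
  finally show "(1 / 2)\<^sup>2 \<le> (exp (\<epsilon> / (1 - \<epsilon>)) * ((1 - \<epsilon>) * sqrt (1 - \<epsilon>)))\<^sup>2"
    by (simp add: y_def power2_eq_square)
qed (use assms in simp)

text \<open>Up to constants in the exponent, \<open>\<tau>\<^sup>2 / 2\<close> is
  \<open>1 + y\<close> times \<open>t\<^sup>2 / 2\<close>, where
  \<open>y = \<epsilon> / (1 - \<epsilon>)\<close>. As \<open>exp (- t\<^sup>2 / 2)\<close> is of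
  order \<open>t / 2 ^ k\<close>, multiplying by \<open>2 ^ k\<close> leaves the power
  \<open>2 ^ k\<close> to the \<open>- y\<close>. The factor \<open>exp (- 1)\<close> stands for the
  other blocks.\<close>

lemma gaussian_agreement_bound:
  fixes \<epsilon> t :: real and k :: nat
  assumes \<epsilon>: "0 < \<epsilon>" "\<epsilon> < 1" and k: "10 \<le> k" and k\<epsilon>: "2 * (1 - \<epsilon>) \<le> \<epsilon> * real k"
    and t: "sqrt k \<le> t" "t \<le> 6 / 5 * sqrt k" "std_normal_density t / t = 1 / (2 * 2 ^ k)"
  defines "\<tau> \<equiv> (t + (1 - \<epsilon>) / t) / sqrt (1 - \<epsilon>)" and "h \<equiv> (1 - \<epsilon>) / t / sqrt \<epsilon>"
  shows "0.003 * (\<epsilon> * real k) powr (- 1 / 2) * 2 powr (- (real k * \<epsilon> / (1 - \<epsilon>)))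
    < 2 ^ k * (std_normal_density (\<tau> + 1 / \<tau>) / \<tau> * (2 * h * std_normal_density h)) * exp (- 1)"
proof -
  define N :: real where "N = 2 ^ k"
  define y where "y = \<epsilon> / (1 - \<epsilon>)"
  define P where "P = sqrt (2 * pi)"
  define x where "x = P * t / 2"
  define \<delta> where "\<delta> = (1 - \<epsilon>) / (2 * t\<^sup>2) + 1 / (2 * \<tau>\<^sup>2) + h\<^sup>2 / 2"
  have P: "2 < P" "P < 283 / 100" using sqrt_two_pi_bounds by (auto simp: P_def)
  have N: "0 < N" by (simp add: N_def)
  have sk: "3 \<le> sqrt k" using k by (simp add: real_le_rsqrt)
  then have t0: "3 \<le> t" using t by simp
  have "(sqrt k)\<^sup>2 \<le> t\<^sup>2" using t by (intro power_mono) auto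
  then have t2: "real k \<le> t\<^sup>2" "10 \<le> t\<^sup>2" using k by auto
  have \<tau>0: "0 < \<tau>" unfolding \<tau>_def using \<epsilon> t0 by (intro divide_pos_pos add_pos_pos) auto
  \<comment> \<open>The shift \<open>(1 - \<epsilon>) / t\<close> makes the cross term of the square
    exactly 2.\<close>
  have \<tau>2: "\<tau>\<^sup>2 = t\<^sup>2 * (1 + y) + 2 + (1 - \<epsilon>) / t\<^sup>2"
    unfolding \<tau>_def y_def using \<epsilon> t0 by (simp add: power_divide power2_eq_square field_simps)
  have y0: "0 < y" using \<epsilon> by (simp add: y_def)
  have "t\<^sup>2 * 1 \<le> t\<^sup>2 * (1 + y)" using y0 by (intro mult_left_mono) auto
  moreover have "0 \<le> (1 - \<epsilon>) / t\<^sup>2" using \<epsilon> by simp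
  ultimately have \<tau>2': "10 \<le> \<tau>\<^sup>2" using t2 by (simp add: \<tau>2)
  \<comment> \<open>The lower bound \<open>2 * (1 - \<epsilon>) / \<epsilon>\<close> on
    \<open>k\<close> enters here: the density at \<open>h\<close> then costs only a
    constant.\<close>
  have h2: "h\<^sup>2 \<le> 1 / 2"
  proof -
    have "(1 - \<epsilon>) * (1 - \<epsilon>) \<le> 1 * (1 - \<epsilon>)" using \<epsilon> by (intro mult_right_mono) auto
    also have "\<dots> \<le> \<epsilon> * real k / 2" using k\<epsilon> by simp
    also have "\<dots> \<le> \<epsilon> * t\<^sup>2 / 2" using t2 \<epsilon> by simp
    finally show ?thesis unfolding h_def using \<epsilon> t0 by (simp add: power_divide power2_eq_square field_simps)
  qed
  have \<delta>: "\<delta> \<le> 1 / 2"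
  proof -
    have "(1 - \<epsilon>) / (2 * t\<^sup>2) \<le> 1 / (2 * 10)" using \<epsilon> t2 by (intro frac_le) auto
    moreover have "1 / (2 * \<tau>\<^sup>2) \<le> 1 / (2 * 10)" using \<tau>2' by (intro frac_le) auto
    ultimately show ?thesis using h2 unfolding \<delta>_def by linarith
  qed
  have xe: "exp 1 \<le> x"
  proof -
    have "2 * 3 \<le> P * t" using P t0 by (intro mult_mono) auto
    then show ?thesis using exp_one_le by (simp add: x_def)
  qed
  have x0: "0 < x" using xe by (meson exp_gt_zero less_le_trans)
  have density: "std_normal_density u = exp (- u\<^sup>2 / 2) / P" for u
    by (simp add: std_normal_density_def P_def)
  have \<phi>t: "exp (- t\<^sup>2 / 2) = x / N"
    using t(3) t0 P by (simp add: density x_def N_def field_simps)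
  \<comment> \<open>The 3 in the exponent consists of 1 from the cross term in
    \<open>\<tau>\<^sup>2\<close>, 1 from the cross term in this square, and 1 from
    \<open>exp (- 1)\<close>; \<delta> collects the small remainders.\<close>
  have "(\<tau> + 1 / \<tau>)\<^sup>2 = \<tau>\<^sup>2 + 2 + 1 / \<tau>\<^sup>2"
    using \<tau>0 by (simp add: power2_eq_square field_simps)
  moreover have "\<delta> = ((1 - \<epsilon>) / t\<^sup>2 + 1 / \<tau>\<^sup>2 + h\<^sup>2) / 2"
    by (simp add: \<delta>_def add_divide_distrib mult.commute)
  moreover have "(1 + y) * (- t\<^sup>2 / 2) = - (t\<^sup>2 * (1 + y)) / 2" by (simp add: mult.commute)
  ultimately have "- (\<tau> + 1 / \<tau>)\<^sup>2 / 2 - h\<^sup>2 / 2 - 1 = (1 + y) * (- t\<^sup>2 / 2) + (- 3 - \<delta>)"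
    using \<tau>2 by (simp add: field_simps)
  then have "exp (- (\<tau> + 1 / \<tau>)\<^sup>2 / 2) * exp (- h\<^sup>2 / 2) * exp (- 1)
      = exp (- t\<^sup>2 / 2) powr (1 + y) * exp (- 3 - \<delta>)"
    by (simp add: powr_def flip: exp_add)
  also have "\<dots> = x / N * (x powr y * N powr (- y)) * exp (- 3 - \<delta>)"
    unfolding \<phi>t using x0 N by (simp add: powr_add powr_divide powr_minus field_simps)
  finally have "N * (std_normal_density (\<tau> + 1 / \<tau>) / \<tau> * (2 * h * std_normal_density h)) * exp (- 1)
      = N * (1 / P * (1 / P)) / \<tau> * (2 * h) * (x / N * (x powr y * N powr (- y)) * exp (- 3 - \<delta>))"
    by (simp add: density field_simps)
  also have "\<dots> = (x * 2 * h / (P * P)) / \<tau> * (x powr y * N powr (- y)) * exp (- 3 - \<delta>)"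
    using N by (simp add: mult_ac)
  also have "x * 2 * h / (P * P) = (1 - \<epsilon>) / (sqrt \<epsilon> * P)"
    using t0 P \<epsilon> by (simp add: x_def h_def)
  finally have eq: "N * (std_normal_density (\<tau> + 1 / \<tau>) / \<tau> * (2 * h * std_normal_density h)) * exp (- 1)
     = N powr (- y) * ((1 - \<epsilon>) / (sqrt \<epsilon> * P) * (1 / \<tau>) * x powr y * exp (- 3 - \<delta>))"
    by simp
  \<comment> \<open>\<open>132 / 100\<close> is \<open>11 / 10\<close> times \<open>6 / 5\<close>:
    the shift adds at most a tenth of \<open>t\<close>.\<close>
  have "sqrt (1 - \<epsilon>) / (132 / 100 * sqrt k) \<le> 1 / \<tau>"
  proof -
    have "(1 - \<epsilon>) / t \<le> 1 / 10 * t"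
      using \<epsilon> t0 t2 by (simp add: divide_le_eq power2_eq_square)
    then have le: "t + (1 - \<epsilon>) / t \<le> 132 / 100 * sqrt k" using t by linarith
    have pos: "0 < t + (1 - \<epsilon>) / t" using \<epsilon> t0 by (intro add_pos_pos) auto
    have "sqrt (1 - \<epsilon>) / (132 / 100 * sqrt k) \<le> sqrt (1 - \<epsilon>) / (t + (1 - \<epsilon>) / t)"
      by (rule frac_le[OF _ order_refl pos le]) (use \<epsilon> in simp)
    then show ?thesis by (simp add: \<tau>_def)
  qed
  moreover have "exp y \<le> x powr y"
    using powr_mono2[of y "exp 1" x] y0 xe by (simp add: powr_def)
  moreover have "3 / 100 \<le> exp (- 3 - \<delta>)"
  proof -
    have "exp (- (7 / 2)) \<le> exp (- 3 - \<delta>)" using \<delta> by simp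
    then show ?thesis using exp_minus_seven_halves_ge by linarith
  qed
  ultimately have "(1 - \<epsilon>) / (sqrt \<epsilon> * P) * (sqrt (1 - \<epsilon>) / (132 / 100 * sqrt k)) * exp y * (3 / 100)
      \<le> (1 - \<epsilon>) / (sqrt \<epsilon> * P) * (1 / \<tau>) * x powr y * exp (- 3 - \<delta>)"
    using \<epsilon> P sk \<tau>0 by (intro mult_mono) auto
  moreover have "3 / 1000 * (1 / (sqrt \<epsilon> * sqrt k))
      < (1 - \<epsilon>) / (sqrt \<epsilon> * P) * (sqrt (1 - \<epsilon>) / (132 / 100 * sqrt k)) * exp y * (3 / 100)"
  proof -
    have "3 / 1000 * (132 / 100 * P) < 1 / 2 * (3 / 100)" using P by simp
    also have "\<dots> \<le> exp y * ((1 - \<epsilon>) * sqrt (1 - \<epsilon>)) * (3 / 100)"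
      using exp_ratio_bound[OF \<epsilon>] by (intro mult_right_mono) (auto simp: y_def)
    finally have "3 / 1000 < exp y * ((1 - \<epsilon>) * sqrt (1 - \<epsilon>)) * (3 / 100) / (132 / 100 * P)"
      using P by (simp add: pos_less_divide_eq)
    moreover have "0 < sqrt \<epsilon> * sqrt k" using \<epsilon> k by simp
    ultimately have "3 / 1000 * (1 / (sqrt \<epsilon> * sqrt k))
      < exp y * ((1 - \<epsilon>) * sqrt (1 - \<epsilon>)) * (3 / 100) / (132 / 100 * P) * (1 / (sqrt \<epsilon> * sqrt k))"
      by (intro mult_strict_right_mono) auto
    then show ?thesis by (simp add: field_simps)
  qed
  ultimately have "N powr (- y) * (3 / 1000 * (1 / (sqrt \<epsilon> * sqrt k)))
      < N * (std_normal_density (\<tau> + 1 / \<tau>) / \<tau> * (2 * h * std_normal_density h)) * exp (- 1)"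
    unfolding eq using N by (intro mult_strict_left_mono) auto
  moreover have "N powr (- y) = 2 powr (- (real k * \<epsilon> / (1 - \<epsilon>)))"
    by (simp add: N_def y_def powr_powr flip: powr_realpow)
  moreover have "1 / (sqrt \<epsilon> * sqrt k) = (\<epsilon> * real k) powr (- 1 / 2)"
    using \<epsilon> k by (simp add: powr_minus powr_half_sqrt real_sqrt_mult field_simps)
  ultimately show ?thesis by (simp add: N_def mult_ac)
qed

section \<open>Choice of the half space and conclusion\<close>

lemma exists_half_space:
  fixes \<epsilon> :: real and k :: nat
  assumes \<epsilon>: "0 < \<epsilon>" "\<epsilon> < 1" and k: "real k \<ge> 10 + 2 * (1 - \<epsilon>) / \<epsilon>"
  obtains m A where "0.003 * (\<epsilon> * real k) powr (- 1 / 2) * 2 powr (- (real k * \<epsilon> / (1 - \<epsilon>)))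
    \<le> 2 ^ k * measure_pmf.prob (noisy_pair m \<epsilon>) (A \<times> A) *
      measure_pmf.prob (noisy_pair m \<epsilon>) ((- A) \<times> (- A)) ^ (2 ^ k - 1)"
proof -
  define R where "R = 0.003 * (\<epsilon> * real k) powr (- 1 / 2) * 2 powr (- (real k * \<epsilon> / (1 - \<epsilon>)))"
  have "0 < 2 * (1 - \<epsilon>) / \<epsilon>" using \<epsilon> by simp
  then have k10: "10 \<le> k" using k by linarith
  have "2 * (1 - \<epsilon>) / \<epsilon> \<le> real k" using k by simp
  then have k\<epsilon>: "2 * (1 - \<epsilon>) \<le> \<epsilon> * real k" using \<epsilon> by (simp add: field_simps)
  obtain t where t: "sqrt k \<le> t" "t \<le> 6 / 5 * sqrt k" "std_normal_density t / t = 1 / (2 * 2 ^ k)"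
    using exists_threshold[OF k10] .
  have t0: "0 < t" using t(1) k10 by (meson less_le_trans of_nat_0_less_iff real_sqrt_gt_zero zero_less_numeral)
  define s where "s = (1 - \<epsilon>) / t"
  define \<tau> where "\<tau> = (t + s) / sqrt (1 - \<epsilon>)"
  define h where "h = s / sqrt \<epsilon>"
  let ?\<Phi> = "cdf std_normal_distribution"
  have s0: "0 < s" using \<epsilon> t0 by (simp add: s_def)
  have \<tau>0: "0 < \<tau>" using \<epsilon> t0 s0 by (simp add: \<tau>_def)
  have h0: "0 < h" using \<epsilon> s0 by (simp add: h_def)
  have \<Phi>_le_1: "?\<Phi> u \<le> 1" for u
    using real_distribution.cdf_bounded_prob[OF real_dist_normal_dist] .
  have mono: "std_normal_density v \<le> std_normal_density u" if "\<bar>u\<bar> \<le> v" for u v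
    using power_mono[OF that, of 2] by (simp add: std_normal_density_def divide_right_mono)
  \<comment> \<open>The tail is bounded below on a window of width \<open>1 / \<tau>\<close>, over
    which the density falls by only a bounded factor when \<tau> is large.\<close>
  have "std_normal_density (\<tau> + 1 / \<tau>) / \<tau> \<le> 1 - ?\<Phi> \<tau>"
  proof -
    have "(\<tau> + 1 / \<tau> - \<tau>) * std_normal_density (\<tau> + 1 / \<tau>) \<le> ?\<Phi> (\<tau> + 1 / \<tau>) - ?\<Phi> \<tau>"
      by (rule std_normal_interval_ge) (use \<tau>0 in \<open>auto intro!: mono\<close>)
    also have "\<dots> \<le> 1 - ?\<Phi> \<tau>" using \<Phi>_le_1 by simp
    finally show ?thesis by simp
  qed
  moreover have "2 * h * std_normal_density h \<le> ?\<Phi> h - ?\<Phi> (- h)"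
  proof -
    have "(h - - h) * std_normal_density h \<le> ?\<Phi> h - ?\<Phi> (- h)"
      by (rule std_normal_interval_ge) (use h0 in \<open>auto intro!: mono\<close>)
    then show ?thesis by simp
  qed
  ultimately have "std_normal_density (\<tau> + 1 / \<tau>) / \<tau> * (2 * h * std_normal_density h)
      \<le> (1 - ?\<Phi> \<tau>) * (?\<Phi> h - ?\<Phi> (- h))"
    using \<tau>0 h0 \<Phi>_le_1 by (intro mult_mono) auto
  then have "2 ^ k * (std_normal_density (\<tau> + 1 / \<tau>) / \<tau> * (2 * h * std_normal_density h)) * exp (- 1)
      \<le> 2 ^ k * ((1 - ?\<Phi> \<tau>) * (?\<Phi> h - ?\<Phi> (- h))) * exp (- 1)"
    by (intro mult_right_mono mult_left_mono) auto
  with gaussian_agreement_bound[OF \<epsilon> k10 k\<epsilon> t]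
  have "R < 2 ^ k * ((1 - ?\<Phi> \<tau>) * (?\<Phi> h - ?\<Phi> (- h))) * exp (- 1)"
    unfolding R_def \<tau>_def h_def s_def by linarith
  then have "R / (2 ^ k * exp (- 1)) < (1 - ?\<Phi> \<tau>) * (?\<Phi> h - ?\<Phi> (- h))"
    by (simp add: pos_divide_less_eq mult_ac)
  \<comment> \<open>Strict inequality on both sides leaves room for the two limits as
    \<open>m\<close> grows.\<close>
  then obtain \<gamma> where \<gamma>: "R / (2 ^ k * exp (- 1)) < \<gamma>" "\<gamma> < (1 - ?\<Phi> \<tau>) * (?\<Phi> h - ?\<Phi> (- h))"
    using dense by blast
  have "0 \<le> R / (2 ^ k * exp (- 1))" by (simp add: R_def)
  then have \<gamma>0: "0 < \<gamma>" using \<gamma>(1) by linarith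
  define q where "q m = measure_pmf.prob (sign_walk m) {x. x > t * sqrt m}" for m
  define Q where "Q = measure std_normal_distribution {t<..}"
  have q: "q \<longlonglongrightarrow> Q"
    unfolding q_def Q_def by (rule sign_walk_tail_tendsto)
  have "Q \<le> 1 / (2 * 2 ^ k)" using std_normal_tail_le[OF t0] t(3) by (simp add: Q_def)
  then have Q: "1 - 1 / real (2 ^ k) \<le> 1 - 2 * Q" by (simp add: field_simps)
  have N2: "2 \<le> (2 ^ k :: nat)" using k10 by (cases k) auto
  have "R < 2 ^ k * \<gamma> * exp (- 1)"
    using \<gamma>(1) by (simp add: pos_divide_less_eq mult_ac)
  also have "\<dots> \<le> 2 ^ k * \<gamma> * (1 - 1 / real (2 ^ k)) ^ (2 ^ k - 1)"
    using \<gamma>0 exp_minus_one_le_power[OF N2] by (intro mult_left_mono) auto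
  also have "\<dots> \<le> 2 ^ k * \<gamma> * (1 - 2 * Q) ^ (2 ^ k - 1)"
    using \<gamma>0 Q by (intro mult_left_mono power_mono) auto
  finally have R: "R < 2 ^ k * \<gamma> * (1 - 2 * Q) ^ (2 ^ k - 1)" .
  have "(\<lambda>m. 2 ^ k * \<gamma> * (1 - 2 * q m) ^ (2 ^ k - 1)) \<longlonglongrightarrow> 2 ^ k * \<gamma> * (1 - 2 * Q) ^ (2 ^ k - 1)"
    by (intro tendsto_intros q)
  then have "\<forall>\<^sub>F m in sequentially. R < 2 ^ k * \<gamma> * (1 - 2 * q m) ^ (2 ^ k - 1)"
    using R by (rule order_tendstoD)
  \<comment> \<open>Positivity of the base is what makes the power monotone in the final
    comparison.\<close>
  moreover have "\<forall>\<^sub>F m in sequentially. 0 < 1 - 2 * q m"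
  proof (rule order_tendstoD)
    show "(\<lambda>m. 1 - 2 * q m) \<longlonglongrightarrow> 1 - 2 * Q" by (intro tendsto_intros q)
    have "1 / real (2 ^ k) \<le> 1 / real 2" using of_nat_mono[OF N2] by (rule frac_le[rotated 3]) auto
    then show "0 < 1 - 2 * Q" using Q by linarith
  qed
  moreover have "\<forall>\<^sub>F m in sequentially.
      \<gamma> \<le> measure_pmf.prob (noisy_pair m \<epsilon>) (half_space t m \<times> half_space t m)"
    using \<gamma>(2) \<gamma>0 t0 s0 \<epsilon> unfolding \<tau>_def h_def by (intro eventually_half_space_joint) auto
  ultimately have "\<forall>\<^sub>F m in sequentially.
      R \<le> 2 ^ k * measure_pmf.prob (noisy_pair m \<epsilon>) (half_space t m \<times> half_space t m) *
      measure_pmf.prob (noisy_pair m \<epsilon>) ((- half_space t m) \<times> (- half_space t m)) ^ (2 ^ k - 1)"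
  proof eventually_elim
    case (elim m)
    have "1 - 2 * q m \<le> measure_pmf.prob (noisy_pair m \<epsilon>) ((- half_space t m) \<times> (- half_space t m))"
      unfolding q_def by (rule half_space_marginals) (use \<epsilon> in auto)
    with elim have "2 ^ k * \<gamma> * (1 - 2 * q m) ^ (2 ^ k - 1) \<le>
      2 ^ k * measure_pmf.prob (noisy_pair m \<epsilon>) (half_space t m \<times> half_space t m) *
      measure_pmf.prob (noisy_pair m \<epsilon>) ((- half_space t m) \<times> (- half_space t m)) ^ (2 ^ k - 1)"
      using \<gamma>0 by (intro mult_mono power_mono) auto
    with elim show ?case by linarith
  qed
  from eventually_happens'[OF sequentially_bot this] show ?thesis
    unfolding R_def by (blast intro: that)
qed

theorem theorem4:
  fixes \<epsilon> :: real and k :: nat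
  assumes "0 < \<epsilon>" and "\<epsilon> < 1"
    and "0 < k" and "real k \<ge> 10 + 2 * (1 - \<epsilon>) / \<epsilon>"
  shows "\<exists>n0::nat. \<forall>n\<ge>n0. \<exists>f :: bool list \<Rightarrow> bool list.
    f \<in> bitstrings n \<rightarrow> bitstrings k \<and>
    (\<forall>z\<in>bitstrings k.
      \<P>((x, y) in measure_pmf (noisy_pair n \<epsilon>). f x = z) = 1 / 2 ^ k \<and>
      \<P>((x, y) in measure_pmf (noisy_pair n \<epsilon>). f x = f y \<and> f y = z \<bar> f x = f y) = 1 / 2 ^ k) \<and>
    \<P>((x, y) in measure_pmf (noisy_pair n \<epsilon>). f x = f y)
      \<ge> 0.003 * (\<epsilon> * real k) powr (- 1 / 2) * 2 powr (- (real k * \<epsilon> / (1 - \<epsilon>)))"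
proof -
  let ?R = "0.003 * (\<epsilon> * real k) powr (- 1 / 2) * 2 powr (- (real k * \<epsilon> / (1 - \<epsilon>)))"
  \<comment> \<open>Positivity of the bound ensures that the event \<open>f x = f y\<close> has
    positive probability, so conditioning on it is a true quotient.\<close>
  have R: "0 < ?R" using assms by simp
  obtain m A where mA: "?R \<le> 2 ^ k * measure_pmf.prob (noisy_pair m \<epsilon>) (A \<times> A) *
      measure_pmf.prob (noisy_pair m \<epsilon>) ((- A) \<times> (- A)) ^ (2 ^ k - 1)"
    using exists_half_space[OF assms(1,2,4)] .
  show ?thesis
  \<comment> \<open>The length needed by the blocks and the tie-breaking bits; \<open>m\<close> was
    fixed before \<open>n\<close>.\<close>
  proof (intro exI[of _ "2 ^ k * m + k"] allI impI)
    fix n assume n: "2 ^ k * m + k \<le> n"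
    define M where "M = measure_pmf.prob (noisy_pair n \<epsilon>)"
    obtain f where f: "f \<in> bitstrings n \<rightarrow> bitstrings k"
      and unif: "\<And>z. z \<in> bitstrings k \<Longrightarrow> M {(x, y). f x = z} = 1 / 2 ^ k"
        "\<And>z. z \<in> bitstrings k \<Longrightarrow> M {(x, y). f x = f y \<and> f y = z} = M {(x, y). f x = f y} / 2 ^ k"
      and agree: "?R \<le> M {(x, y). f x = f y}"
      using exists_equivariant_function[of \<epsilon> k m n A] n mA assms(1,2) unfolding M_def
      by (meson less_imp_le order_trans)
    have eq: "\<P>((x, y) in measure_pmf (noisy_pair n \<epsilon>). p x y) = M {(x, y). p x y}" for p
      by (simp add: M_def)
    show "\<exists>f :: bool list \<Rightarrow> bool list.
      f \<in> bitstrings n \<rightarrow> bitstrings k \<and>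
      (\<forall>z\<in>bitstrings k.
        \<P>((x, y) in measure_pmf (noisy_pair n \<epsilon>). f x = z) = 1 / 2 ^ k \<and>
        \<P>((x, y) in measure_pmf (noisy_pair n \<epsilon>). f x = f y \<and> f y = z \<bar> f x = f y) = 1 / 2 ^ k) \<and>
      \<P>((x, y) in measure_pmf (noisy_pair n \<epsilon>). f x = f y) \<ge> ?R"
    proof (intro exI[of _ f] conjI ballI f)
      fix z assume z: "z \<in> bitstrings k"
      show "\<P>((x, y) in measure_pmf (noisy_pair n \<epsilon>). f x = z) = 1 / 2 ^ k"
        unfolding eq by (rule unif(1)[OF z])
      have "{w. (case w of (x, y) \<Rightarrow> f x = f y \<and> f y = z) \<and> (case w of (x, y) \<Rightarrow> f x = f y)}
          = {(x, y). f x = f y \<and> f y = z}" by auto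
      then show "\<P>((x, y) in measure_pmf (noisy_pair n \<epsilon>). f x = f y \<and> f y = z \<bar> f x = f y) = 1 / 2 ^ k"
        unfolding cond_prob_def using unif(2)[OF z] agree R by (simp add: M_def)
    next
      show "\<P>((x, y) in measure_pmf (noisy_pair n \<epsilon>). f x = f y) \<ge> ?R"
        unfolding eq by (rule agree)
    qed
  qed
qed

end
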